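(* Let $(X,\mathcal F)$ be a strongly equicontinuous, compact foliated space. Then the closure of each leaf is a minimal set. In particular, $\mathcal F$ is minimal (every leaf is dense) if it is transitive (some leaf is dense).
   Context: **Foliated spaces.** A locally compact Polish space $X$ is a foliated space if it has an open cover $\{U_i\}$ with homeomorphisms $\phi_i:U_i\to B_i\times Z_i$ (flow boxes), $B_i$ an open ball of finite radius in $\mathbb R^n$, $Z_i$ a Polish space, with coordinate changes $\phi_i\circ\phi_j^{-1}(x_j,z_j)=(x_i(x_j,z_j),z_i(z_j))$, $z_i$ continuous, and $x_i$ of class $C^k$ in the sense that its partial derivatives up to order $k$ in the $\mathbb R^n$-directions exist and are continuous in $(x_j,z_j)$. The sets $\phi_i^{-1}(B_i\times\{z\})$ are plaques. The leaves are the connected components of $X$ in the finer topology with basis the open subsets of plaques. A minimal set is a non-empty closed union of leaves in which every leaf is dense. **Holonomy pseudogroup.** Let $p_i:U_i\to Z_i$ be the composite of $\phi_i$ with the projection $B_i\times Z_i\to Z_i$, and $Z_{i,j}=p_i(U_i\cap U_j)$. For a suitable (regular) cover there are homeomorphisms $h_{i,j}:Z_{i,j}\to Z_{j,i}$ with $p_j=h_{i,j}\circ p_i$ on $U_i\cap U_j$. The $h_{i,j}$ generate a pseudogroup $\mathcal H$ on $Z=\bigsqcup_iZ_i$, the holonomy pseudogroup. **Pseudogroups.** A pseudogroup of local transformations of a space $Z$ is a collection $\mathcal H$ of homeomorphisms between open subsets of $Z$ containing $\mathrm{id}_Z$ and closed under composition (wherever defined), inversion, restriction to open sets and combination (union)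 of maps. It is generated by $E\subset\mathcal H$ if all its elements are obtained from $E$ by these operations. $E$ is symmetric if $h\in E\Rightarrow h^{-1}\in E$. **Quasi-local metrics.** A cover of a set $Z$ by quasi-locally equal metric spaces is a family $\{(Z_i,d_i)\}_{i\in I}$ of metric spaces with $Z=\bigcup_iZ_i$, each $Z_i\cap Z_j$ open in $(Z_i,d_i)$ and in $(Z_j,d_j)$, such that for all $\varepsilon>0$ there is $\delta(\varepsilon)>0$ so that: for all $i,j\in I$ and $z\in Z_i\cap Z_j$ there is an open neighborhood $U_{i,j,z}$ of $z$ in $Z_i\cap Z_j$ with $d_i(x,y)<\delta(\varepsilon)\Rightarrow d_j(x,y)<\varepsilon$ for all $\varepsilon>0$ and $x,y\in U_{i,j,z}$. Two such families are equivalent if their union is again such a family; an equivalence class $\mathfrak Q$ is a quasi-local metric. It induces a topology on $Z$ with base the open balls of all $(Z_i,d_i)$. **Strong equicontinuity.** A pseudogroup $\mathcal H$ on a space $Z$ is strongly equicontinuous if there are a quasi-local metric $\mathfrak Q$ inducing the topology of $Z$, some $\{(Z_i,d_i)\}_{i\in I}\in\mathfrak Q$ and a symmetric set $S$ of generators of $\mathcal H$, closed under compositions, such that for every $\varepsilon>0$ there is $\delta(\varepsilon)>0$ with $d_i(x,y)<\delta(\varepsilon)\Rightarrow d_j(h(x),h(y))<\varepsilon$ for all $h\in S$, $i,j\in I$ and $x,y\in Z_i\cap h^{-1}(Z_j\cap\operatorname{im}h)$. A foliated space is strongly equicontinuous if its holonomy pseudogroup is (this is independent of the chosen representative). *)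

theory Defs
  imports "HOL-Analysis.Analysis"
begin

section \<open>Foliated spaces\<close>

record ('a, 'n::finite, 'z) flow_box =
  box_dom :: "'a set"
  box_ball :: "(real ^ 'n) set"
  box_transversal :: "'z topology"
  box_map :: "'a \<Rightarrow> (real ^ 'n) \<times> 'z"

definition polish_topology :: "'a topology \<Rightarrow> bool"
  where "polish_topology X \<longleftrightarrow> completely_metrizable_space X \<and> second_countable X"

definition is_flow_box :: "'a topology \<Rightarrow> ('a, 'n::finite, 'z) flow_box \<Rightarrow> bool"
  where "is_flow_box X b \<longleftrightarrow>
    openin X (box_dom b) \<and>
    (\<exists>c r. r > 0 \<and> box_ball b = ball c r) \<and>
    polish_topology (box_transversal b) \<and>
    homeomorphic_map (subtopology X (box_dom b))
      (prod_topology (top_of_set (box_ball b)) (box_transversal b)) (box_map b)"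

text \<open>
  All partial derivatives of \<open>f\<close> up to order \<open>m\<close> in the Euclidean directions exist on \<open>W\<close> and are
  continuous in both variables jointly. It is only used for \<open>W\<close> open in the product.
\<close>

primrec leafwise_C ::
  "nat \<Rightarrow> 'z topology \<Rightarrow> ((real ^ 'n) \<times> 'z) set \<Rightarrow> ((real ^ 'n) \<times> 'z \<Rightarrow> real ^ 'n) \<Rightarrow> bool"
  where
    "leafwise_C 0 T W f \<longleftrightarrow>
       continuous_map (subtopology (prod_topology euclidean T) W) euclidean f"
  | "leafwise_C (Suc m) T W f \<longleftrightarrow>
       continuous_map (subtopology (prod_topology euclidean T) W) euclidean f \<and>
       (\<forall>i. \<exists>g.
         (\<forall>x z. (x, z) \<in> W \<longrightarrow>
           ((\<lambda>t. f (x + t *\<^sub>R axis i 1, z)) has_vector_derivative g (x, z)) (at 0)) \<and>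
         leafwise_C m T W g)"

definition coord_change ::
  "('a, 'n::finite, 'z) flow_box \<Rightarrow> ('a, 'n, 'z) flow_box \<Rightarrow> (real ^ 'n) \<times> 'z \<Rightarrow> (real ^ 'n) \<times> 'z"
  where "coord_change b c = box_map b \<circ> inv_into (box_dom c) (box_map c)"

text \<open>
  As usual for foliations, the transverse coordinate is required to depend only on the transverse
  coordinate \<^emph>\<open>locally\<close>: a plaque of one flow box may meet several plaques of another. The global
  version is part of \<open>regular_atlas\<close> below.
\<close>

definition foliated_change ::
  "enat \<Rightarrow> ('a, 'n::finite, 'z) flow_box \<Rightarrow> ('a, 'n, 'z) flow_box \<Rightarrow> bool"
  where "foliated_change k b c \<longleftrightarrow>
    (let W = box_map c ` (box_dom b \<inter> box_dom c); f = coord_change b c in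
      (\<forall>m. enat m \<le> k \<longrightarrow> leafwise_C m (box_transversal c) W (fst \<circ> f)) \<and>
      (\<forall>w\<in>W. \<exists>N \<zeta>.
        openin (prod_topology euclidean (box_transversal c)) N \<and> w \<in> N \<and> N \<subseteq> W \<and>
        continuous_map (subtopology (box_transversal c) (snd ` N)) (box_transversal b) \<zeta> \<and>
        (\<forall>v\<in>N. snd (f v) = \<zeta> (snd v))))"

definition foliated_atlas :: "enat \<Rightarrow> 'a topology \<Rightarrow> ('a, 'n::finite, 'z) flow_box set \<Rightarrow> bool"
  where "foliated_atlas k X \<A> \<longleftrightarrow>
    (\<forall>b\<in>\<A>. is_flow_box X b) \<and> (\<Union>b\<in>\<A>. box_dom b) = topspace X \<and>
    (\<forall>b\<in>\<A>. \<forall>c\<in>\<A>. foliated_change k b c)"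

definition foliated_space :: "enat \<Rightarrow> 'a topology \<Rightarrow> ('a, 'n::finite, 'z) flow_box set \<Rightarrow> bool"
  where "foliated_space k X \<A> \<longleftrightarrow>
    locally_compact_space X \<and> polish_topology X \<and> foliated_atlas k X \<A>"

definition plaques :: "('a, 'n::finite, 'z) flow_box set \<Rightarrow> 'a set set"
  where "plaques \<A> =
    {{p \<in> box_dom b. snd (box_map b p) = z} | b z. b \<in> \<A> \<and> z \<in> topspace (box_transversal b)}"

text \<open>For a foliated atlas the generating sets are closed under finite intersections, hence a base.\<close>

definition leaf_topology :: "'a topology \<Rightarrow> ('a, 'n::finite, 'z) flow_box set \<Rightarrow> 'a topology"
  where "leaf_topology X \<A> =
    topology_generated_by {V. \<exists>P\<in>plaques \<A>. openin (subtopology X P) V}"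

definition leaves :: "'a topology \<Rightarrow> ('a, 'n::finite, 'z) flow_box set \<Rightarrow> 'a set set"
  where "leaves X \<A> = connected_components_of (leaf_topology X \<A>)"

definition minimal_set :: "'a topology \<Rightarrow> ('a, 'n::finite, 'z) flow_box set \<Rightarrow> 'a set \<Rightarrow> bool"
  where "minimal_set X \<A> M \<longleftrightarrow>
    M \<noteq> {} \<and> closedin X M \<and> (\<exists>\<L>\<subseteq>leaves X \<A>. M = \<Union>\<L>) \<and>
    (\<forall>L\<in>leaves X \<A>. L \<subseteq> M \<longrightarrow> subtopology X M closure_of L = M)"

definition minimal_foliation :: "'a topology \<Rightarrow> ('a, 'n::finite, 'z) flow_box set \<Rightarrow> bool"
  where "minimal_foliation X \<A> \<longleftrightarrow> (\<forall>L\<in>leaves X \<A>. X closure_of L = topspace X)"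

definition transitive_foliation :: "'a topology \<Rightarrow> ('a, 'n::finite, 'z) flow_box set \<Rightarrow> bool"
  where "transitive_foliation X \<A> \<longleftrightarrow> (\<exists>L\<in>leaves X \<A>. X closure_of L = topspace X)"


section \<open>Pseudogroups\<close>

text \<open>
  Local transformations are represented by their graphs, so that composition (with maximal domain),
  inversion and combination are \<open>(O)\<close>, \<open>converse\<close> and \<open>\<Union>\<close>.
\<close>

definition local_transformation :: "'z topology \<Rightarrow> ('z \<times> 'z) set \<Rightarrow> bool"
  where "local_transformation T h \<longleftrightarrow>
    (\<exists>U V f. openin T U \<and> openin T V \<and>
      homeomorphic_map (subtopology T U) (subtopology T V) f \<and> h = {(x, f x) | x. x \<in> U})"

definition pseudogroup :: "'z topology \<Rightarrow> ('z \<times> 'z) set set \<Rightarrow> bool"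
  where "pseudogroup T H \<longleftrightarrow>
    (\<forall>h\<in>H. local_transformation T h) \<and>
    Id_on (topspace T) \<in> H \<and>
    (\<forall>g\<in>H. \<forall>h\<in>H. g O h \<in> H) \<and>
    (\<forall>h\<in>H. converse h \<in> H) \<and>
    (\<forall>h\<in>H. \<forall>U. openin T U \<longrightarrow> h \<inter> (U \<times> UNIV) \<in> H) \<and>
    (\<forall>K. K \<subseteq> H \<and> local_transformation T (\<Union>K) \<longrightarrow> \<Union>K \<in> H)"

inductive_set generated_pseudogroup :: "'z topology \<Rightarrow> ('z \<times> 'z) set set \<Rightarrow> ('z \<times> 'z) set set"
  for T :: "'z topology" and E :: "('z \<times> 'z) set set"
  where
    generator: "h \<in> E \<Longrightarrow> h \<in> generated_pseudogroup T E"
  | identity: "Id_on (topspace T) \<in> generated_pseudogroup T E"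
  | composition: "\<lbrakk>g \<in> generated_pseudogroup T E; h \<in> generated_pseudogroup T E\<rbrakk>
      \<Longrightarrow> g O h \<in> generated_pseudogroup T E"
  | inversion: "h \<in> generated_pseudogroup T E \<Longrightarrow> converse h \<in> generated_pseudogroup T E"
  | restriction: "\<lbrakk>h \<in> generated_pseudogroup T E; openin T U\<rbrakk>
      \<Longrightarrow> h \<inter> (U \<times> UNIV) \<in> generated_pseudogroup T E"
  | combination: "\<lbrakk>\<And>h. h \<in> K \<Longrightarrow> h \<in> generated_pseudogroup T E; local_transformation T (\<Union>K)\<rbrakk>
      \<Longrightarrow> \<Union>K \<in> generated_pseudogroup T E"


lemma local_transformation_converse:
  assumes "local_transformation T h"
  shows "local_transformation T (converse h)"
proof -
  obtain U V f where op: "openin T U" "openin T V"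
    and hom: "homeomorphic_map (subtopology T U) (subtopology T V) f"
    and h: "h = {(x, f x) | x. x \<in> U}"
    using assms unfolding local_transformation_def by blast
  obtain g where fg: "homeomorphic_maps (subtopology T U) (subtopology T V) f g"
    using hom homeomorphic_map_maps by blast
  have U: "topspace (subtopology T U) = U" and V: "topspace (subtopology T V) = V"
    using op by (auto simp: openin_subset Int_absorb1)
  have *: "\<forall>x\<in>U. g (f x) = x" "\<forall>y\<in>V. f (g y) = y" "\<forall>x\<in>U. f x \<in> V" "\<forall>y\<in>V. g y \<in> U"
    using fg U V unfolding homeomorphic_maps_def continuous_map_def by auto
  have "converse h = {(y, g y) | y. y \<in> V}"
    unfolding h using * by (auto simp: converse_unfold)
  moreover have "homeomorphic_map (subtopology T V) (subtopology T U) g"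
    using fg homeomorphic_maps_map by blast
  ultimately show ?thesis
    using op unfolding local_transformation_def by blast
qed

lemma local_transformation_restrict:
  assumes "local_transformation T h" and W: "openin T W"
  shows "local_transformation T (h \<inter> (W \<times> UNIV))"
proof -
  obtain U V f where op: "openin T U" "openin T V"
    and hom: "homeomorphic_map (subtopology T U) (subtopology T V) f"
    and h: "h = {(x, f x) | x. x \<in> U}"
    using assms unfolding local_transformation_def by blast
  have sub: "U \<inter> W \<subseteq> topspace (subtopology T U)"
    using op by (auto dest: openin_subset)
  have oUW: "openin (subtopology T U) (U \<inter> W)"
    using W by (auto simp: openin_subtopology)
  then have "openin (subtopology T V) (f ` (U \<inter> W))"
    using hom homeomorphic_map_openness_eq by blast
  then have opim: "openin T (f ` (U \<inter> W))" and fV: "f ` (U \<inter> W) \<subseteq> V"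
    using op openin_trans_full apply blast
    using \<open>openin (subtopology T V) (f ` (U \<inter> W))\<close> openin_subset by fastforce
  have "homeomorphic_map (subtopology (subtopology T U) (U \<inter> W))
      (subtopology (subtopology T V) (f ` (U \<inter> W))) f"
    by (rule homeomorphic_map_subtopologies[OF hom])
       (use op hom fV in \<open>auto dest!: openin_subset homeomorphic_imp_injective_map
          simp: inj_on_def\<close>, (metis subsetD)?)
  then have "homeomorphic_map (subtopology T (U \<inter> W)) (subtopology T (f ` (U \<inter> W))) f"
    using fV by (simp add: subtopology_subtopology Int_absorb1 inf.absorb_iff2)
  moreover have "h \<inter> (W \<times> UNIV) = {(x, f x) | x. x \<in> U \<inter> W}"
    unfolding h by auto
  ultimately show ?thesis
    using opim op W unfolding local_transformation_def by blast
qed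

lemma local_transformation_comp:
  assumes "local_transformation T g" "local_transformation T h"
  shows "local_transformation T (g O h)"
proof -
  obtain U V f where g: "openin T U" "openin T V"
    "homeomorphic_map (subtopology T U) (subtopology T V) f" "g = {(x, f x) | x. x \<in> U}"
    using assms(1) unfolding local_transformation_def by blast
  obtain U' V' f' where h: "openin T U'" "openin T V'"
    "homeomorphic_map (subtopology T U') (subtopology T V') f'" "h = {(x, f' x) | x. x \<in> U'}"
    using assms(2) unfolding local_transformation_def by blast
  define g1 where "g1 = converse (converse g \<inter> (U' \<times> UNIV))"
  define h1 where "h1 = h \<inter> (V \<times> UNIV)"
  have lt: "local_transformation T g1" "local_transformation T h1"
    unfolding g1_def h1_def
    using assms g h local_transformation_converse local_transformation_restrict by blast+
  have img: "f ` U = V"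
    using homeomorphic_imp_surjective_map[OF g(3)] g(1,2) by (simp add: openin_subset Int_absorb1)
  have eq: "g O h = g1 O h1" and rng: "Range g1 = Domain h1"
    unfolding g1_def h1_def g(4) h(4) using img by auto
  obtain A B a where a: "openin T A" "openin T B"
    "homeomorphic_map (subtopology T A) (subtopology T B) a" "g1 = {(x, a x) | x. x \<in> A}"
    using lt(1) unfolding local_transformation_def by blast
  obtain C D c where c: "openin T C" "openin T D"
    "homeomorphic_map (subtopology T C) (subtopology T D) c" "h1 = {(x, c x) | x. x \<in> C}"
    using lt(2) unfolding local_transformation_def by blast
  have imga: "a ` A = B"
    using homeomorphic_imp_surjective_map[OF a(3)] a(1,2) by (simp add: openin_subset Int_absorb1)
  have "Range g1 = a ` A" "Domain h1 = C"
    using a(4) c(4) by auto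
  then have BC: "B = C"
    using rng imga by simp
  have "homeomorphic_map (subtopology T A) (subtopology T D) (c \<circ> a)"
    using a(3) c(3) BC homeomorphic_map_compose by blast
  moreover have "g1 O h1 = {(x, (c \<circ> a) x) | x. x \<in> A}"
    using a(4) c(4) BC imga by auto
  ultimately show ?thesis
    unfolding eq local_transformation_def using a(1) c(2) by blast
qed

lemma local_transformation_Id_on: "local_transformation T (Id_on (topspace T))"
proof -
  have "Id_on (topspace T) = {(x, id x) | x. x \<in> topspace T}"
    by auto
  moreover have "homeomorphic_map (subtopology T (topspace T)) (subtopology T (topspace T)) id"
    by (simp add: homeomorphic_map_id)
  ultimately show ?thesis
    unfolding local_transformation_def by blast
qed

lemma pseudogroup_generated_pseudogroup:
  assumes "\<forall>h\<in>E. local_transformation T h"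
  shows "pseudogroup T (generated_pseudogroup T E)"
proof -
  have "local_transformation T h" if "h \<in> generated_pseudogroup T E" for h
    using that
    by induction (use assms in \<open>auto intro: local_transformation_converse
      local_transformation_restrict local_transformation_comp local_transformation_Id_on\<close>)
  then show ?thesis
    unfolding pseudogroup_def by (auto intro: generated_pseudogroup.intros)
qed

lemma generated_pseudogroup_least:
  assumes "pseudogroup T H" "E \<subseteq> H"
  shows "generated_pseudogroup T E \<subseteq> H"
proof
  fix h assume "h \<in> generated_pseudogroup T E"
  then show "h \<in> H"
    by induction (use assms in \<open>auto simp: pseudogroup_def subset_iff\<close>)
qed


section \<open>Quasi-local metrics and strong equicontinuity\<close>

definition quasi_locally_equal_cover :: "'z set \<Rightarrow> 'z metric set \<Rightarrow> bool"
  where "quasi_locally_equal_cover Z Q \<longleftrightarrow>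
    (\<Union>m\<in>Q. mspace m) = Z \<and>
    (\<forall>m\<in>Q. \<forall>m'\<in>Q.
      openin (mtopology_of m) (mspace m \<inter> mspace m') \<and>
      openin (mtopology_of m') (mspace m \<inter> mspace m')) \<and>
    (\<exists>\<delta> :: real \<Rightarrow> real.
      (\<forall>\<epsilon>>0. \<delta> \<epsilon> > 0) \<and>
      (\<forall>m\<in>Q. \<forall>m'\<in>Q. \<forall>z \<in> mspace m \<inter> mspace m'.
        \<exists>U. openin (mtopology_of m) U \<and> z \<in> U \<and> U \<subseteq> mspace m \<inter> mspace m' \<and>
          (\<forall>\<epsilon>>0. \<forall>x\<in>U. \<forall>y\<in>U. mdist m x y < \<delta> \<epsilon> \<longrightarrow> mdist m' x y < \<epsilon>)))"

definition quasi_local_equivalence :: "'z set \<Rightarrow> ('z metric set \<times> 'z metric set) set"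
  where "quasi_local_equivalence Z =
    {(P, Q). quasi_locally_equal_cover Z P \<and> quasi_locally_equal_cover Z Q \<and>
      quasi_locally_equal_cover Z (P \<union> Q)}"

definition quasi_local_metric :: "'z set \<Rightarrow> 'z metric set set \<Rightarrow> bool"
  where "quasi_local_metric Z \<QQ> \<longleftrightarrow>
    \<QQ> \<in> {Q. quasi_locally_equal_cover Z Q} // quasi_local_equivalence Z"

definition induces_topology :: "'z metric set set \<Rightarrow> 'z topology \<Rightarrow> bool"
  where "induces_topology \<QQ> T \<longleftrightarrow>
    openin T = arbitrary union_of
      (\<lambda>B. \<exists>Q\<in>\<QQ>. \<exists>m\<in>Q. \<exists>x\<in>mspace m. \<exists>r>0.
        B = mball_of m x r)"

definition strongly_equicontinuous :: "'z topology \<Rightarrow> ('z \<times> 'z) set set \<Rightarrow> bool"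
  where "strongly_equicontinuous T H \<longleftrightarrow>
    (\<exists>\<QQ>. quasi_local_metric (topspace T) \<QQ> \<and> induces_topology \<QQ> T \<and>
      (\<exists>Q\<in>\<QQ>. \<exists>S\<subseteq>H.
        generated_pseudogroup T S = H \<and>
        (\<forall>h\<in>S. converse h \<in> S) \<and>
        (\<forall>g\<in>S. \<forall>h\<in>S. g O h \<in> S) \<and>
        (\<forall>\<epsilon>>0. \<exists>\<delta>>0. \<forall>h\<in>S. \<forall>m\<in>Q. \<forall>m'\<in>Q. \<forall>x y x' y'.
          (x, x') \<in> h \<and> (y, y') \<in> h \<and> x \<in> mspace m \<and> y \<in> mspace m \<and>
          x' \<in> mspace m' \<and> y' \<in> mspace m' \<and> mdist m x y < \<delta> \<longrightarrow> mdist m' x' y' < \<epsilon>)))"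


section \<open>Holonomy\<close>

definition box_proj :: "('a, 'n::finite, 'z) flow_box \<Rightarrow> 'a \<Rightarrow> 'z"
  where "box_proj b = snd \<circ> box_map b"

text \<open>
  The only property of regular covers that enters the construction of the holonomy pseudogroup:
  the homeomorphisms \<open>h\<^bsub>b,c\<^esub>\<close> between the projections of \<open>U\<^bsub>b\<^esub> \<inter> U\<^bsub>c\<^esub>\<close> exist.
\<close>

definition regular_atlas :: "enat \<Rightarrow> 'a topology \<Rightarrow> ('a, 'n::finite, 'z) flow_box set \<Rightarrow> bool"
  where "regular_atlas k X \<A> \<longleftrightarrow> foliated_atlas k X \<A> \<and>
    (\<forall>b\<in>\<A>. \<forall>c\<in>\<A>. \<exists>h.
      homeomorphic_map
        (subtopology (box_transversal b) (box_proj b ` (box_dom b \<inter> box_dom c)))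
        (subtopology (box_transversal c) (box_proj c ` (box_dom b \<inter> box_dom c))) h \<and>
      (\<forall>p \<in> box_dom b \<inter> box_dom c. box_proj c p = h (box_proj b p)))"

definition holonomy_space ::
  "('a, 'n::finite, 'z) flow_box set \<Rightarrow> (('a, 'n, 'z) flow_box \<times> 'z) topology"
  where "holonomy_space \<A> = sum_topology box_transversal \<A>"

text \<open>The graph of \<open>h\<^bsub>b,c\<^esub>\<close>, as a local transformation of the disjoint union of the transversals.\<close>

definition holonomy_map ::
  "('a, 'n::finite, 'z) flow_box \<Rightarrow> ('a, 'n, 'z) flow_box \<Rightarrow>
    ((('a, 'n, 'z) flow_box \<times> 'z) \<times> (('a, 'n, 'z) flow_box \<times> 'z)) set"
  where "holonomy_map b c =
    {((b, box_proj b p), (c, box_proj c p)) | p. p \<in> box_dom b \<inter> box_dom c}"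

definition holonomy_pseudogroup ::
  "('a, 'n::finite, 'z) flow_box set \<Rightarrow>
    ((('a, 'n, 'z) flow_box \<times> 'z) \<times> (('a, 'n, 'z) flow_box \<times> 'z)) set set"
  where "holonomy_pseudogroup \<A> =
    generated_pseudogroup (holonomy_space \<A>) {holonomy_map b c | b c. b \<in> \<A> \<and> c \<in> \<A>}"

text \<open>
  The holonomy pseudogroup is taken with respect to some regular atlas \<open>\<B>\<close> of the same foliated
  structure, i.e. such that \<open>\<A> \<union> \<B>\<close> is still a foliated atlas.
\<close>

definition strongly_equicontinuous_foliated_space ::
  "enat \<Rightarrow> 'a topology \<Rightarrow> ('a, 'n::finite, 'z) flow_box set \<Rightarrow> bool"
  where "strongly_equicontinuous_foliated_space k X \<A> \<longleftrightarrow>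
    (\<exists>\<B>. regular_atlas k X \<B> \<and> foliated_atlas k X (\<A> \<union> \<B>) \<and>
      strongly_equicontinuous (holonomy_space \<B>) (holonomy_pseudogroup \<B>))"

end

theory Submission
  imports Defs
begin

text \<open>
  The closure of a leaf \<open>L\<close> is saturated because the projections of flow boxes are open. It remains to
  show that \<open>L\<close> lies in the closure of every leaf \<open>L'\<close> that meets the closure of \<open>L\<close> in a point \<open>q\<close>.
  Choose \<open>x0\<close> in \<open>L\<close> very close to \<open>q\<close> and carry \<open>x0\<close> along \<open>L\<close> by holonomy. By strong equicontinuity
  the corresponding point of \<open>L'\<close>, obtained from \<open>q\<close>, stays uniformly close as long as it is defined,
  and by compactness (a Lebesgue number for the domains of the holonomy maps) closeness guarantees that
  it can be continued. Instead of following chains of plaques, one observes that the set of points of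
  \<open>L\<close> up to which this works is open and closed in the leaf topology.
\<close>

section \<open>Flow boxes and the leaf topology\<close>

text \<open>Strong equicontinuity controls only the elements of the chosen generating set
  \<open>S\<close>, and a holonomy map need be neither one of them nor a restriction of one. What
  survives generation is germs: near each point of its domain a holonomy map agrees with an element
  of \<open>S\<close> or with the identity. The Lebesgue number is therefore chosen so that one
  element of \<open>S\<^sub>1\<close> represents the holonomy map at both of two close points. Since
  \<open>S\<close> is closed under composition, the elements met while following a leaf compose to a
  single element of \<open>S\<^sub>1\<close>, so one \<delta> serves for the whole journey, however
  long; estimating step by step would lose control of the distance.

  The transversals need not be compact, and the atlas \<open>\<B>\<close> supplied by the hypothesis
  may be infinite and different from \<open>\<A>\<close>. Compactness is therefore taken from
  \<open>X\<close> itself, through finitely many closed subsets of flow boxes, and the passage from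
  \<open>\<A>\<close> to \<open>\<B>\<close> is reduced to equality of the two leaf
  topologies.\<close>

lemma openin_box_dom: "is_flow_box X b \<Longrightarrow> openin X (box_dom b)"
  by (simp add: is_flow_box_def)

lemma continuous_map_box_map:
  assumes "is_flow_box X b"
  shows "continuous_map (subtopology X (box_dom b))
    (prod_topology (top_of_set (box_ball b)) (box_transversal b)) (box_map b)"
  using assms by (auto simp: is_flow_box_def intro: homeomorphic_imp_continuous_map)

lemma inj_on_box_map:
  assumes "is_flow_box X b"
  shows "inj_on (box_map b) (box_dom b)"
proof -
  have "inj_on (box_map b) (topspace (subtopology X (box_dom b)))"
    using assms homeomorphic_imp_injective_map unfolding is_flow_box_def by blast
  then show ?thesis
    using openin_box_dom[OF assms] by (simp add: openin_subset Int_absorb1)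
qed

lemma continuous_map_box_proj:
  assumes "is_flow_box X b"
  shows "continuous_map (subtopology X (box_dom b)) (box_transversal b) (box_proj b)"
  unfolding box_proj_def
  using continuous_map_box_map[OF assms] continuous_map_snd by (rule continuous_map_compose)

lemma box_proj_in_topspace:
  assumes "is_flow_box X b" "p \<in> box_dom b"
  shows "box_proj b p \<in> topspace (box_transversal b)"
  using continuous_map_box_proj[OF assms(1)] openin_box_dom[OF assms(1)] assms(2)
  by (auto simp: continuous_map_def Pi_iff dest: openin_subset)

lemma openin_box_proj_vimage:
  assumes "is_flow_box X b" "openin (box_transversal b) U" "openin X W"
  shows "openin X {p \<in> W \<inter> box_dom b. box_proj b p \<in> U}"
proof -
  have "openin (subtopology X (box_dom b)) {p \<in> W \<inter> box_dom b. box_proj b p \<in> U}"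
    using continuous_map_box_proj[OF assms(1)] openin_subtopology_Int[OF assms(3)] assms(2)
    by (rule openin_continuous_map_preimage_gen)
  then show ?thesis
    using openin_box_dom[OF assms(1)] openin_trans_full by blast
qed

lemma openin_box_proj_image:
  assumes "is_flow_box X b" "openin X W"
  shows "openin (box_transversal b) (box_proj b ` (W \<inter> box_dom b))"
proof -
  have "open_map (subtopology X (box_dom b)) (box_transversal b) (box_proj b)"
    unfolding box_proj_def
    by (rule open_map_compose[OF _ open_map_snd])
      (use assms(1) homeomorphic_imp_open_map in \<open>auto simp: is_flow_box_def\<close>)
  then show ?thesis
    using assms(2) by (auto simp: open_map_def openin_subtopology_Int)
qed

text \<open>Plaques are named by a point instead of a transverse coordinate, because plaques of
  different boxes are compared at a common point.\<close>

definition plaque_through :: "('a, 'n::finite, 'z) flow_box \<Rightarrow> 'a \<Rightarrow> 'a set"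
  where "plaque_through b p = {q \<in> box_dom b. box_proj b q = box_proj b p}"

lemma plaque_through_in_plaques:
  assumes "is_flow_box X b" "b \<in> \<A>" "p \<in> box_dom b"
  shows "plaque_through b p \<in> plaques \<A>"
  using box_proj_in_topspace[OF assms(1,3)] assms(2)
  unfolding plaques_def plaque_through_def box_proj_def comp_def by blast

text \<open>Saturating an open set by the plaques of one box keeps it open, since
  \<open>box_proj b\<close> is continuous and open. This carries approximation by a leaf from one
  point of a plaque to another.\<close>

lemma openin_meets_plaque:
  assumes "is_flow_box X b" "openin X W" "q \<in> W" "q \<in> box_dom b" "p \<in> box_dom b"
    and "box_proj b p = box_proj b q"
  obtains V where "openin X V" "p \<in> V"
    "\<And>x. x \<in> V \<Longrightarrow> x \<in> box_dom b \<and> (\<exists>y\<in>W \<inter> box_dom b. box_proj b y = box_proj b x)"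
proof
  let ?V = "{x \<in> topspace X \<inter> box_dom b. box_proj b x \<in> box_proj b ` (W \<inter> box_dom b)}"
  show "openin X ?V"
    using openin_box_proj_vimage[OF assms(1) openin_box_proj_image[OF assms(1,2)] openin_topspace] .
  show "p \<in> ?V"
    using assms openin_subset[OF openin_box_dom[OF assms(1)]] by auto
  show "x \<in> box_dom b \<and> (\<exists>y\<in>W \<inter> box_dom b. box_proj b y = box_proj b x)" if "x \<in> ?V" for x
    using that by force
qed

text \<open>The transverse part of the coordinate change is a function of the transverse coordinate
  near \<open>p\<close>, so points of one plaque of \<open>c\<close> close to \<open>p\<close> share
  their coordinate in \<open>b\<close>. The restriction to \<open>U\<close> matters: further away
  the same plaque of \<open>c\<close> may enter another plaque of \<open>b\<close>.\<close>

lemma foliated_change_plaque_nhd: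
  assumes ch: "foliated_change k b c" and fb: "is_flow_box X b" and fc: "is_flow_box X c"
    and p: "p \<in> box_dom b" "p \<in> box_dom c"
  obtains U where "openin X U" "p \<in> U" "plaque_through c p \<inter> U \<subseteq> plaque_through b p"
proof -
  let ?W = "box_map c ` (box_dom b \<inter> box_dom c)"
  have loc: "\<forall>w\<in>?W. \<exists>N \<zeta>. openin (prod_topology euclidean (box_transversal c)) N \<and> w \<in> N \<and> N \<subseteq> ?W \<and>
      continuous_map (subtopology (box_transversal c) (snd ` N)) (box_transversal b) \<zeta> \<and>
      (\<forall>v\<in>N. snd (coord_change b c v) = \<zeta> (snd v))"
    using ch unfolding foliated_change_def Let_def by (rule conjunct2)
  have "box_map c p \<in> ?W"
    using p by blast
  from bspec[OF loc this] obtain N \<zeta> where N: "openin (prod_topology euclidean (box_transversal c)) N"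
      "box_map c p \<in> N" "N \<subseteq> ?W" and \<zeta>: "\<forall>v\<in>N. snd (coord_change b c v) = \<zeta> (snd v)"
    by (elim exE conjE)
  have c_eq: "coord_change b c (box_map c q) = box_map b q" if "q \<in> box_dom c" for q
    unfolding coord_change_def using inj_on_box_map[OF fc] that by simp
  let ?U = "{q \<in> box_dom c. box_map c q \<in> N}"
  have "continuous_map (subtopology X (box_dom c)) (prod_topology euclidean (box_transversal c)) (box_map c)"
    using continuous_map_box_map[OF fc]
    by (simp add: continuous_map_pairwise continuous_map_in_subtopology)
  moreover have "topspace (subtopology X (box_dom c)) = box_dom c"
    using openin_box_dom[OF fc] by (simp add: openin_subset Int_absorb1)
  ultimately have "openin (subtopology X (box_dom c)) ?U"
    using openin_continuous_map_preimage[OF _ N(1)] by fastforce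
  then have "openin X ?U"
    using openin_box_dom[OF fc] openin_trans_full by blast
  moreover have "plaque_through c p \<inter> ?U \<subseteq> plaque_through b p"
  proof
    fix q assume q: "q \<in> plaque_through c p \<inter> ?U"
    then have "box_map c q \<in> ?W"
      using N by blast
    \<comment> \<open>\<open>box_map c q\<close> is the image of some point of both boxes, and
      injectivity makes that point \<open>q\<close>.\<close>
    then have "q \<in> box_dom b"
      using q inj_on_box_map[OF fc] by (auto simp: inj_on_def)
    moreover have "snd (box_map b q) = snd (box_map b p)"
      using q p N(2) c_eq[of p] c_eq[of q] bspec[OF \<zeta>, of "box_map c p"] bspec[OF \<zeta>, of "box_map c q"]
      by (auto simp: plaque_through_def box_proj_def)
    ultimately show "q \<in> plaque_through b p"
      by (simp add: plaque_through_def box_proj_def)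
  qed
  moreover have "p \<in> ?U"
    using p N by blast
  ultimately show thesis
    using that[of ?U] by blast
qed

lemma foliated_atlas_plaque_nhd:
  assumes "foliated_atlas k X \<A>" and "b \<in> \<A>" "c \<in> \<A>" and p: "p \<in> box_dom b" "p \<in> box_dom c"
  obtains U where "openin X U" "p \<in> U" "plaque_through c p \<inter> U \<subseteq> plaque_through b p"
proof -
  have "foliated_change k b c" "is_flow_box X b" "is_flow_box X c"
    using assms by (auto simp: foliated_atlas_def)
  then show thesis
    using p that by (rule foliated_change_plaque_nhd)
qed

text \<open>This makes the topologies of overlapping plaques compatible, so that the leaf topology
  induces on each plaque nothing finer than the topology of \<open>X\<close>.\<close>

lemma openin_plaque_through_Int:
  assumes "foliated_atlas k X \<A>" "b \<in> \<A>" "c \<in> \<A>"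
  shows "openin (subtopology X (plaque_through c x)) (plaque_through c x \<inter> plaque_through b y)"
proof (subst openin_subopen, safe)
  fix p assume p: "p \<in> plaque_through c x" "p \<in> plaque_through b y"
  then have eq: "plaque_through c x = plaque_through c p" "plaque_through b y = plaque_through b p"
    by (auto simp: plaque_through_def)
  obtain U where U: "openin X U" "p \<in> U" "plaque_through c p \<inter> U \<subseteq> plaque_through b p"
    using foliated_atlas_plaque_nhd[OF assms, of p] p by (auto simp: plaque_through_def)
  show "\<exists>T. openin (subtopology X (plaque_through c x)) T \<and> p \<in> T \<and>
      T \<subseteq> plaque_through c x \<inter> plaque_through b y"
    using U p unfolding eq by (intro exI[of _ "plaque_through c p \<inter> U"]) (auto simp: openin_subtopology_Int2)
qed

lemma openin_leaf_topology_plaque: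
  assumes "P \<in> plaques \<A>" "openin (subtopology X P) V"
  shows "openin (leaf_topology X \<A>) V"
  using assms unfolding leaf_topology_def by (blast intro: topology_generated_by_Basis)

lemma plaques_cases:
  assumes "P \<in> plaques \<A>"
  obtains "P = {}" | b p where "b \<in> \<A>" "p \<in> box_dom b" "P = plaque_through b p"
proof -
  obtain b z where b: "b \<in> \<A>" and P: "P = {p \<in> box_dom b. box_proj b p = z}"
    using assms by (auto simp: plaques_def box_proj_def)
  show thesis
  proof (cases "P = {}")
    case False
    then obtain p where "p \<in> P"
      by blast
    then show thesis
      using that(2)[of b p] b P by (auto simp: plaque_through_def)
  qed (rule that(1))
qed

lemma topspace_leaf_topology:
  assumes "foliated_atlas k X \<A>"
  shows "topspace (leaf_topology X \<A>) = topspace X"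
proof
  show "topspace (leaf_topology X \<A>) \<subseteq> topspace X"
    unfolding leaf_topology_def
    by (auto dest!: openin_subset)
  show "topspace X \<subseteq> topspace (leaf_topology X \<A>)"
  proof
    fix p assume p: "p \<in> topspace X"
    then obtain b where b: "b \<in> \<A>" "p \<in> box_dom b" "is_flow_box X b"
      using assms unfolding foliated_atlas_def by blast
    then have "openin (leaf_topology X \<A>) (topspace (subtopology X (plaque_through b p)))"
      by (meson openin_leaf_topology_plaque openin_topspace plaque_through_in_plaques)
    then show "p \<in> topspace (leaf_topology X \<A>)"
      using b p openin_subset by (fastforce simp: plaque_through_def)
  qed
qed

lemma openin_leaf_topology_plaque_through:
  assumes "foliated_atlas k X \<A>" "b \<in> \<A>" "p \<in> box_dom b" "openin X W"
  shows "openin (leaf_topology X \<A>) (plaque_through b p \<inter> W)"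
  using assms openin_leaf_topology_plaque plaque_through_in_plaques openin_subtopology_Int2
  unfolding foliated_atlas_def by metis

text \<open>A plaque is the image of a ball under the inverse chart, hence connected in
  \<open>X\<close>. The leaf topology is finer than that of \<open>X\<close>, so this is not yet
  enough; but the identity from the plaque, with the topology of \<open>X\<close>, into the leaf
  topology is continuous because plaques meet in relatively open sets.\<close>

lemma connectedin_plaque_through:
  assumes at: "foliated_atlas k X \<A>" and b: "b \<in> \<A>" and p: "p \<in> box_dom b"
  shows "connectedin (leaf_topology X \<A>) (plaque_through b p)"
proof -
  let ?P = "plaque_through b p"
  have fb: "is_flow_box X b"
    using at b by (auto simp: foliated_atlas_def)
  then obtain g where g: "homeomorphic_maps (subtopology X (box_dom b))
      (prod_topology (top_of_set (box_ball b)) (box_transversal b)) (box_map b) g"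
    unfolding is_flow_box_def homeomorphic_map_maps by blast
  have sp: "topspace (subtopology X (box_dom b)) = box_dom b"
    using openin_box_dom[OF fb] by (simp add: openin_subset Int_absorb1)
  let ?Q = "box_ball b \<times> {box_proj b p}"
  have "connected (box_ball b)"
    using fb by (auto simp: is_flow_box_def)
  then have "connectedin (prod_topology (top_of_set (box_ball b)) (box_transversal b)) ?Q"
    using box_proj_in_topspace[OF fb p] by (auto simp: connectedin_Times connectedin_subtopology)
  then have "connectedin (subtopology X (box_dom b)) (g ` ?Q)"
    using g connectedin_continuous_map_image unfolding homeomorphic_maps_def by blast
  moreover have "g ` ?Q = ?P"
  proof
    have "g v \<in> box_dom b \<and> box_map b (g v) = v" if "v \<in> ?Q" for v
      using that g sp box_proj_in_topspace[OF fb p]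
      unfolding homeomorphic_maps_def continuous_map_def by (auto simp: Pi_iff)
    then show "g ` ?Q \<subseteq> ?P"
      by (auto simp: plaque_through_def box_proj_def)
    show "?P \<subseteq> g ` ?Q"
    proof
      fix q assume q: "q \<in> ?P"
      then have "q \<in> box_dom b" "box_map b q \<in> ?Q"
        using continuous_map_box_map[OF fb] sp
        by (auto simp: plaque_through_def box_proj_def continuous_map_def Pi_iff mem_Times_iff)
      then show "q \<in> g ` ?Q"
        using g sp unfolding homeomorphic_maps_def by force
    qed
  qed
  ultimately have "connectedin X ?P"
    by (simp add: connectedin_subtopology)
  moreover have "continuous_map (subtopology X ?P) (leaf_topology X \<A>) id"
    unfolding leaf_topology_def
  proof (rule continuous_on_generated_topo)
    fix V assume "V \<in> {V. \<exists>P\<in>plaques \<A>. openin (subtopology X P) V}"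
    then obtain P where P: "P \<in> plaques \<A>" "openin (subtopology X P) V"
      by blast
    then obtain W where W: "openin X W" "V = W \<inter> P"
      by (auto simp: openin_subtopology)
    have "openin (subtopology X ?P) (?P \<inter> P)"
      using P(1)
    proof (cases rule: plaques_cases)
      case (2 c q)
      then show ?thesis
        using openin_plaque_through_Int[OF at _ b] by blast
    qed auto
    moreover have "openin (subtopology X ?P) (?P \<inter> W)"
      using W by (simp add: openin_subtopology_Int2)
    ultimately have "openin (subtopology X ?P) ((?P \<inter> P) \<inter> (?P \<inter> W))"
      by blast
    moreover have "id -` V \<inter> topspace (subtopology X ?P) = (?P \<inter> P) \<inter> (?P \<inter> W)"
      using W openin_subset[OF W(1)] by auto
    ultimately show "openin (subtopology X ?P) (id -` V \<inter> topspace (subtopology X ?P))"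
      by simp
  next
    show "id ` topspace (subtopology X ?P) \<subseteq> \<Union> {V. \<exists>P\<in>plaques \<A>. openin (subtopology X P) V}"
      using topspace_leaf_topology[OF at] unfolding leaf_topology_def by auto
  qed
  ultimately have "connectedin (leaf_topology X \<A>) (id ` ?P)"
    using connectedin_continuous_map_image connectedin_absolute by blast
  then show ?thesis
    by simp
qed

text \<open>Around each of its points an open piece of a plaque of \<open>\<B>\<close> contains an
  open piece of a plaque of \<open>\<A>\<close>, by compatibility of the two atlases. It is needed
  because equicontinuity is given for an atlas other than the one defining the leaves.\<close>

lemma openin_leaf_topology_mono:
  assumes at: "foliated_atlas k X \<A>" and at': "foliated_atlas k X (\<A> \<union> \<B>)"
    and V: "openin (leaf_topology X \<B>) V"
  shows "openin (leaf_topology X \<A>) V"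
proof -
  have "openin (leaf_topology X \<A>) V"
    if "generate_topology_on {V. \<exists>P\<in>plaques \<B>. openin (subtopology X P) V} V" for V
    using that
  proof induction
    case (Basis V)
    then obtain P W where P: "P \<in> plaques \<B>" and W: "openin X W" "V = W \<inter> P"
      by (auto simp: openin_subtopology)
    show ?case
      using P
    proof (cases rule: plaques_cases)
      case (2 b q)
      show ?thesis
      proof (subst openin_subopen, safe)
        fix p assume p: "p \<in> V"
        then have pb: "p \<in> box_dom b" and eq: "P = plaque_through b p"
          using W 2 by (auto simp: plaque_through_def)
        have "p \<in> topspace X"
          using W p openin_subset by blast
        then obtain a where a: "a \<in> \<A>" "p \<in> box_dom a"
          using at unfolding foliated_atlas_def by blast
        obtain U where U: "openin X U" "p \<in> U" "plaque_through a p \<inter> U \<subseteq> plaque_through b p"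
          using foliated_atlas_plaque_nhd[OF at', of b a p] a 2(1) pb by blast
        show "\<exists>T. openin (leaf_topology X \<A>) T \<and> p \<in> T \<and> T \<subseteq> V"
        proof (intro exI conjI)
          show "openin (leaf_topology X \<A>) (plaque_through a p \<inter> (U \<inter> W))"
            using U W openin_leaf_topology_plaque_through[OF at a] by blast
          show "p \<in> plaque_through a p \<inter> (U \<inter> W)"
            using U W p a by (auto simp: plaque_through_def)
          show "plaque_through a p \<inter> (U \<inter> W) \<subseteq> V"
            using U W eq by auto
        qed
      qed
    qed (use W in auto)
  qed auto
  then show ?thesis
    using V unfolding leaf_topology_def[of X \<B>] openin_topology_generated_by_iff by blast
qed

lemma leaf_topology_eq:
  assumes "foliated_atlas k X \<A>" "foliated_atlas k X \<B>" "foliated_atlas k X (\<A> \<union> \<B>)"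
  shows "leaf_topology X \<A> = leaf_topology X \<B>"
  using assms unfolding topology_eq by (metis openin_leaf_topology_mono sup_commute)

text \<open>The local hypothesis is symmetric in \<open>x\<close> and \<open>y\<close>, so
  \<open>P\<close> and its negation both spread over \<open>N\<close>; the set where
  \<open>P\<close> holds is clopen in a connected space.\<close>

lemma connectedin_local_induct:
  assumes con: "connectedin Y L" and p0: "p0 \<in> L" "P p0" and p: "p \<in> L"
    and loc: "\<And>p. p \<in> L \<Longrightarrow> \<exists>N. openin Y N \<and> p \<in> N \<and> (\<forall>x\<in>N \<inter> L. \<forall>y\<in>N \<inter> L. P x \<longrightarrow> P y)"
  shows "P p"
proof -
  let ?G = "{x \<in> L. P x}" and ?Y = "subtopology Y L"
  have top: "topspace ?Y = L"
    using connectedin_subset_topspace[OF con] by (simp add: Int_absorb1)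
  have nhd: "\<exists>T. openin ?Y T \<and> x \<in> T \<and> (\<forall>y\<in>T. \<forall>z\<in>T. P y \<longrightarrow> P z)" if x: "x \<in> L" for x
  proof -
    obtain N where N: "openin Y N" "x \<in> N" "\<forall>y\<in>N \<inter> L. \<forall>z\<in>N \<inter> L. P y \<longrightarrow> P z"
      using loc[OF x] by blast
    then show ?thesis
      using x by (intro exI[of _ "N \<inter> L"]) (auto simp: openin_subtopology_Int)
  qed
  have "openin ?Y ?G"
  proof (subst openin_subopen, intro ballI)
    fix x assume "x \<in> ?G"
    then have "x \<in> L" "P x"
      by auto
    then obtain T where T: "openin ?Y T" "x \<in> T" "\<forall>y\<in>T. \<forall>z\<in>T. P y \<longrightarrow> P z"
      using nhd by blast
    then have "T \<subseteq> ?G"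
      using \<open>P x\<close> top openin_subset by blast
    then show "\<exists>T. openin ?Y T \<and> x \<in> T \<and> T \<subseteq> ?G"
      using T by blast
  qed
  moreover have "openin ?Y (L - ?G)"
  proof (subst openin_subopen, intro ballI)
    fix x assume "x \<in> L - ?G"
    then have "x \<in> L" "\<not> P x"
      by auto
    then obtain T where T: "openin ?Y T" "x \<in> T" "\<forall>y\<in>T. \<forall>z\<in>T. P y \<longrightarrow> P z"
      using nhd by blast
    then have "T \<subseteq> L - ?G"
      using \<open>\<not> P x\<close> top openin_subset by blast
    then show "\<exists>T. openin ?Y T \<and> x \<in> T \<and> T \<subseteq> L - ?G"
      using T by blast
  qed
  then have "closedin ?Y ?G"
    using top by (auto simp: closedin_def)
  moreover have "connected_space ?Y"
    using con by (simp add: connectedin_def)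
  ultimately have "?G = {} \<or> ?G = L"
    using top unfolding connected_space_clopen_in by blast
  then show ?thesis
    using p0 p by blast
qed

section \<open>Leaves as unions of plaques, and saturation of their closures\<close>

lemma leaf_subset_topspace:
  assumes "foliated_atlas k X \<A>" "L \<in> leaves X \<A>"
  shows "L \<subseteq> topspace X"
  using assms connected_components_of_subset topspace_leaf_topology unfolding leaves_def by blast

text \<open>A plaque is connected in the leaf topology and a leaf is a component, so a plaque that
  meets a leaf lies in it.\<close>

lemma leaf_plaque_closed:
  assumes "foliated_atlas k X \<A>" "L \<in> leaves X \<A>" "b \<in> \<A>" "p \<in> L" "p \<in> box_dom b"
    and "q \<in> box_dom b" "box_proj b q = box_proj b p"
  shows "q \<in> L"
proof -
  have "p \<in> plaque_through b p"
    using assms(5) by (simp add: plaque_through_def)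
  then have "plaque_through b p \<subseteq> L"
    using assms(2,4) connectedin_plaque_through[OF assms(1,3,5)]
    unfolding leaves_def by (intro connected_components_of_maximal) (auto simp: disjnt_iff)
  then show ?thesis
    using assms by (auto simp: plaque_through_def)
qed

text \<open>The neighborhoods in the leaf topology are pieces of plaques, so a property has to be
  transported only between points with equal transverse coordinate. The freedom to choose
  \<open>W\<close> later allows staying inside a chart smaller than the box.\<close>

lemma leaf_induct:
  assumes at: "foliated_atlas k X \<A>" and L: "L \<in> leaves X \<A>"
    and p0: "p0 \<in> L" "P p0" and p: "p \<in> L"
    and loc: "\<And>p. p \<in> L \<Longrightarrow> \<exists>b\<in>\<A>. \<exists>W. p \<in> box_dom b \<and> openin X W \<and> p \<in> W \<and>
      (\<forall>x\<in>L \<inter> W \<inter> box_dom b. \<forall>y\<in>L \<inter> W \<inter> box_dom b. box_proj b x = box_proj b y \<longrightarrow> P x \<longrightarrow> P y)"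
  shows "P p"
proof (rule connectedin_local_induct[where P = P])
  show "connectedin (leaf_topology X \<A>) L"
    using L by (simp add: leaves_def connectedin_connected_components_of)
  fix p assume "p \<in> L"
  from loc[OF this] obtain b W where b: "b \<in> \<A>" "p \<in> box_dom b" and W: "openin X W" "p \<in> W"
    and P: "\<forall>x\<in>L \<inter> W \<inter> box_dom b. \<forall>y\<in>L \<inter> W \<inter> box_dom b. box_proj b x = box_proj b y \<longrightarrow> P x \<longrightarrow> P y"
    by (elim bexE exE conjE)
  have "\<forall>x\<in>(plaque_through b p \<inter> W) \<inter> L. \<forall>y\<in>(plaque_through b p \<inter> W) \<inter> L. P x \<longrightarrow> P y"
  proof (intro ballI)
    fix x y assume "x \<in> (plaque_through b p \<inter> W) \<inter> L" "y \<in> (plaque_through b p \<inter> W) \<inter> L"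
    then have "x \<in> L \<inter> W \<inter> box_dom b" "y \<in> L \<inter> W \<inter> box_dom b" "box_proj b x = box_proj b y"
      by (simp_all add: plaque_through_def)
    then show "P x \<longrightarrow> P y"
      using P by blast
  qed
  moreover have "p \<in> plaque_through b p \<inter> W"
    using b W by (simp add: plaque_through_def)
  ultimately show "\<exists>N. openin (leaf_topology X \<A>) N \<and> p \<in> N \<and> (\<forall>x\<in>N \<inter> L. \<forall>y\<in>N \<inter> L. P x \<longrightarrow> P y)"
    using openin_leaf_topology_plaque_through[OF at b W(1)]
    by (intro exI[of _ "plaque_through b p \<inter> W"] conjI)
qed (use p0 p in auto)

text \<open>Being a limit of \<open>L\<close> passes between points \<open>x\<close> and
  \<open>y\<close> of one plaque: if \<open>L\<close> enters every neighborhood of \<open>x\<close>,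
  it does so in plaques that also reach a given neighborhood of \<open>y\<close>, and
  \<open>L\<close> contains those plaques.\<close>

lemma leaf_subset_closure_of_leaf:
  assumes at: "foliated_atlas k X \<A>" and L: "L \<in> leaves X \<A>" "L' \<in> leaves X \<A>"
    and p: "p \<in> L'" "p \<in> X closure_of L"
  shows "L' \<subseteq> X closure_of L"
proof
  fix q assume q: "q \<in> L'"
  show "q \<in> X closure_of L"
  proof (rule leaf_induct[OF at L(2), where P = "\<lambda>x. x \<in> X closure_of L"])
    fix r assume r: "r \<in> L'"
    then have "r \<in> topspace X"
      using leaf_subset_topspace[OF at L(2)] by blast
    then obtain b where b: "b \<in> \<A>" "r \<in> box_dom b"
      using at unfolding foliated_atlas_def by blast
    then have fb: "is_flow_box X b"
      using at by (simp add: foliated_atlas_def)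
    have "y \<in> X closure_of L"
      if x: "x \<in> box_dom b" "x \<in> X closure_of L" and y: "y \<in> box_dom b" "box_proj b x = box_proj b y" for x y
      unfolding in_closure_of
    proof (intro conjI allI impI)
      show "y \<in> topspace X"
        using y openin_subset[OF openin_box_dom[OF fb]] by blast
      fix W assume W: "y \<in> W \<and> openin X W"
      obtain V where V: "openin X V" "x \<in> V"
        "\<And>x. x \<in> V \<Longrightarrow> x \<in> box_dom b \<and> (\<exists>y\<in>W \<inter> box_dom b. box_proj b y = box_proj b x)"
        using openin_meets_plaque[OF fb _ _ y(1) x(1) y(2)] W by blast
      obtain l where l: "l \<in> L" "l \<in> V"
        using x(2) V(1,2) unfolding in_closure_of by blast
      then obtain l' where "l' \<in> W" "l' \<in> box_dom b" "box_proj b l' = box_proj b l"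
        using V(3) by blast
      then show "\<exists>y. y \<in> L \<and> y \<in> W"
        using leaf_plaque_closed[OF at L(1) b(1) l(1)] V(3) l(2) by blast
    qed
    then show "\<exists>b\<in>\<A>. \<exists>W. r \<in> box_dom b \<and> openin X W \<and> r \<in> W \<and>
      (\<forall>x\<in>L' \<inter> W \<inter> box_dom b. \<forall>y\<in>L' \<inter> W \<inter> box_dom b. box_proj b x = box_proj b y \<longrightarrow>
        x \<in> X closure_of L \<longrightarrow> y \<in> X closure_of L)"
      using b \<open>r \<in> topspace X\<close> by (intro bexI[of _ b] exI[of _ "topspace X"]) auto
  qed (use p q in auto)
qed

section \<open>Germs of a generated pseudogroup\<close>

text \<open>A homeomorphism between open sets expressed through its graph alone, with no function or
  domain to choose, so that stability under the pseudogroup operations becomes relation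
  algebra.\<close>

definition open_partial_bijection :: "'z topology \<Rightarrow> ('z \<times> 'z) set \<Rightarrow> bool"
  where "open_partial_bijection T h \<longleftrightarrow> h \<subseteq> topspace T \<times> topspace T \<and>
    single_valued h \<and> single_valued (converse h) \<and>
    (\<forall>U. openin T U \<longrightarrow> openin T (h `` U) \<and> openin T (converse h `` U))"

lemma local_transformation_single_valued: "local_transformation T h \<Longrightarrow> single_valued h"
  by (auto simp: local_transformation_def single_valued_def)

lemma open_partial_bijection_Id_on: "open_partial_bijection T (Id_on (topspace T))"
proof -
  have "Id_on (topspace T) `` U = U" if "openin T U" for U
    using openin_subset[OF that] by auto
  then show ?thesis
    by (auto simp: open_partial_bijection_def single_valued_def)
qed

lemma open_partial_bijection_generated_pseudogroup:
  assumes "\<And>h. h \<in> E \<Longrightarrow> open_partial_bijection T h" and "h \<in> generated_pseudogroup T E"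
  shows "open_partial_bijection T h"
  using assms(2)
proof induction
  case (generator h)
  then show ?case
    using assms(1) by blast
next
  case identity
  show ?case
    by (rule open_partial_bijection_Id_on)
next
  case (composition g h)
  then show ?case
    unfolding open_partial_bijection_def
    by (auto simp: relcomp_Image converse_relcomp single_valued_relcomp)
next
  case (inversion h)
  then show ?case
    by (auto simp: open_partial_bijection_def)
next
  case (restriction h U)
  have "(h \<inter> U \<times> UNIV) `` V = h `` (U \<inter> V)" "converse (h \<inter> U \<times> UNIV) `` V = U \<inter> converse h `` V" for V
    by auto
  moreover have "single_valued (h \<inter> U \<times> UNIV)" "single_valued (converse (h \<inter> U \<times> UNIV))"
    using restriction by (auto simp: open_partial_bijection_def single_valued_def)
  ultimately show ?case
    using restriction unfolding open_partial_bijection_def by auto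
next
  case (combination K)
  have "\<Union>K `` V = (\<Union>h\<in>K. h `` V)" "converse (\<Union>K) `` V = (\<Union>h\<in>K. converse h `` V)" for V
    by auto
  then have "openin T (\<Union>K `` V) \<and> openin T (converse (\<Union>K) `` V)" if "openin T V" for V
    using combination.IH that unfolding open_partial_bijection_def by auto
  moreover have "\<Union>K \<subseteq> topspace T \<times> topspace T"
    using combination.IH unfolding open_partial_bijection_def by blast
  \<comment> \<open>A union of partial bijections may fail to be single-valued; here the side
    condition of \<open>combination\<close> excludes this.\<close>
  moreover have "single_valued (\<Union>K)" "single_valued (converse (\<Union>K))"
    using combination.hyps local_transformation_single_valued local_transformation_converse by blast+
  ultimately show ?case
    unfolding open_partial_bijection_def by blast
qed

text \<open>Restriction and combination create no new germs, while composition and inversion do not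
  leave \<open>S\<close>. Only the identity has to be adjoined, since the generated pseudogroup
  contains it and \<open>S\<close> may not.\<close>

lemma generated_pseudogroup_germ:
  assumes bi: "\<And>s. s \<in> S \<Longrightarrow> open_partial_bijection T s"
    and conv: "\<And>s. s \<in> S \<Longrightarrow> converse s \<in> S"
    and comp: "\<And>g h. g \<in> S \<Longrightarrow> h \<in> S \<Longrightarrow> g O h \<in> S"
    and h: "h \<in> generated_pseudogroup T S" "(u, v) \<in> h"
  shows "\<exists>s\<in>insert (Id_on (topspace T)) S. \<exists>U. openin T U \<and> u \<in> U \<and> (u, v) \<in> s \<and> s \<inter> (U \<times> UNIV) \<subseteq> h"
proof -
  define S' where "S' = insert (Id_on (topspace T)) S"
  have bi': "open_partial_bijection T s" if "s \<in> S'" for s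
    using that bi open_partial_bijection_Id_on unfolding S'_def by blast
  have Id_comp: "Id_on (topspace T) O s = s" "s O Id_on (topspace T) = s" if "s \<in> S'" for s
    using bi'[OF that] by (auto simp: open_partial_bijection_def)
  have comp': "g O h \<in> S'" if "g \<in> S'" "h \<in> S'" for g h
    using that comp Id_comp[OF that(1)] Id_comp[OF that(2)] unfolding S'_def by auto
  have conv': "converse s \<in> S'" if "s \<in> S'" for s
    using that conv by (auto simp: S'_def)
  have "\<exists>s U. s \<in> S' \<and> openin T U \<and> u \<in> U \<and> (u, v) \<in> s \<and> s \<inter> (U \<times> UNIV) \<subseteq> h"
    using h
  proof (induction arbitrary: u v)
    case (generator h)
    then have "u \<in> topspace T" "h \<in> S'"
      using bi by (auto simp: open_partial_bijection_def S'_def)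
    then show ?case
      using generator by blast
  next
    case identity
    then have "u \<in> topspace T" "Id_on (topspace T) \<in> S'"
      by (auto simp: S'_def)
    then show ?case
      using identity by blast
  next
    case (composition g h)
    then obtain w where w: "(u, w) \<in> g" "(w, v) \<in> h"
      by blast
    obtain s U where s: "s \<in> S'" "openin T U" "u \<in> U" "(u, w) \<in> s" "s \<inter> (U \<times> UNIV) \<subseteq> g"
      using composition.IH(1)[OF w(1)] by blast
    obtain t V where t: "t \<in> S'" "openin T V" "w \<in> V" "(w, v) \<in> t" "t \<inter> (V \<times> UNIV) \<subseteq> h"
      using composition.IH(2)[OF w(2)] by blast
    \<comment> \<open>\<open>t\<close> is known to represent \<open>h\<close> only on
      \<open>V\<close>, so \<open>U\<close> is cut down to the points that \<open>s\<close> sends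
      there.\<close>
    have "openin T (U \<inter> converse s `` V)"
      using bi'[OF s(1)] s(2) t(2) unfolding open_partial_bijection_def by blast
    moreover have "(s O t) \<inter> ((U \<inter> converse s `` V) \<times> UNIV) \<subseteq> g O h"
    proof clarsimp
      fix x y z v' assume "(x, y) \<in> s" "(y, z) \<in> t" "x \<in> U" "v' \<in> V" "(x, v') \<in> s"
      moreover from this have "v' = y"
        using bi'[OF s(1)] unfolding open_partial_bijection_def single_valued_def by blast
      ultimately show "(x, z) \<in> g O h"
        using s(5) t(5) by blast
    qed
    moreover have "s O t \<in> S'"
      using comp' s(1) t(1) by blast
    moreover have "u \<in> U \<inter> converse s `` V" "(u, v) \<in> s O t"
      using s t by blast+
    ultimately show ?case
      by blast
  next
    case (inversion h)
    then obtain s U where s: "s \<in> S'" "openin T U" "v \<in> U" "(v, u) \<in> s" "s \<inter> (U \<times> UNIV) \<subseteq> h"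
      by blast
    have "openin T (s `` U)"
      using bi'[OF s(1)] s(2) unfolding open_partial_bijection_def by blast
    moreover have "converse s \<inter> ((s `` U) \<times> UNIV) \<subseteq> converse h"
    proof clarsimp
      fix x y y' assume "(y, x) \<in> s" "(y', x) \<in> s" "y' \<in> U"
      moreover from this have "y = y'"
        using bi'[OF s(1)] unfolding open_partial_bijection_def single_valued_def by blast
      ultimately show "(y, x) \<in> h"
        using s(5) by blast
    qed
    moreover have "converse s \<in> S'" "u \<in> s `` U" "(u, v) \<in> converse s"
      using s conv' by blast+
    ultimately show ?case
      by blast
  next
    case (restriction h W)
    then obtain s U where s: "s \<in> S'" "openin T U" "u \<in> U" "(u, v) \<in> s" "s \<inter> (U \<times> UNIV) \<subseteq> h"
      by blast
    moreover have "openin T (U \<inter> W)" "u \<in> U \<inter> W" "s \<inter> ((U \<inter> W) \<times> UNIV) \<subseteq> h \<inter> (W \<times> UNIV)"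
      using restriction s by auto
    ultimately show ?case
      by blast
  next
    case (combination K)
    then obtain h where "h \<in> K" "(u, v) \<in> h"
      by blast
    with combination.IH[OF this] show ?case
      by blast
  qed
  then show ?thesis
    unfolding S'_def by blast
qed

section \<open>Holonomy and quasi-local metrics\<close>

text \<open>Regularity of the atlas enters here: a foliated coordinate change gives this only
  locally, which would leave \<open>holonomy_map b c\<close> multivalued when a plaque of
  \<open>b\<close> meets several plaques of \<open>c\<close>.\<close>

lemma regular_atlas_holonomy_functional:
  assumes "regular_atlas k X \<B>" "b \<in> \<B>" "c \<in> \<B>"
    and "p \<in> box_dom b \<inter> box_dom c" "q \<in> box_dom b \<inter> box_dom c" "box_proj b p = box_proj b q"
  shows "box_proj c p = box_proj c q"
proof -
  obtain h where "\<forall>p \<in> box_dom b \<inter> box_dom c. box_proj c p = h (box_proj b p)"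
    using assms(1-3) unfolding regular_atlas_def by blast
  then show ?thesis
    using assms(4-) by simp
qed

lemma openin_holonomy_space_vimage:
  assumes "is_flow_box X b" "b \<in> \<B>" "openin (holonomy_space \<B>) U"
  shows "openin X {p \<in> box_dom b. (b, box_proj b p) \<in> U}"
proof -
  have "openin (box_transversal b) {z. (b, z) \<in> U}"
    using assms(2,3) by (auto simp: holonomy_space_def openin_sum_topology)
  from openin_box_proj_vimage[OF assms(1) this openin_box_dom[OF assms(1)]]
  show ?thesis
    by simp
qed

lemma openin_holonomy_space_image:
  assumes "is_flow_box X b" "b \<in> \<B>" "openin X W"
  shows "openin (holonomy_space \<B>) ((\<lambda>p. (b, box_proj b p)) ` (W \<inter> box_dom b))"
  unfolding holonomy_space_def openin_sum_topology
proof (intro conjI ballI)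
  show "(\<lambda>p. (b, box_proj b p)) ` (W \<inter> box_dom b) \<subseteq> Sigma \<B> (topspace \<circ> box_transversal)"
    using assms(2) box_proj_in_topspace[OF assms(1)] by auto
  fix c
  have "{x. (c, x) \<in> (\<lambda>p. (b, box_proj b p)) ` (W \<inter> box_dom b)} =
      (if c = b then box_proj b ` (W \<inter> box_dom b) else {})"
    by auto
  then show "openin (box_transversal c) {x. (c, x) \<in> (\<lambda>p. (b, box_proj b p)) ` (W \<inter> box_dom b)}"
    using openin_box_proj_image[OF assms(1,3)] by simp
qed

lemma converse_holonomy_map: "converse (holonomy_map b c) = holonomy_map c b"
  by (auto simp: holonomy_map_def)

lemma openin_holonomy_map_image:
  assumes "is_flow_box X b" "is_flow_box X c" "b \<in> \<B>" "c \<in> \<B>" "openin (holonomy_space \<B>) U"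
  shows "openin (holonomy_space \<B>) (holonomy_map b c `` U)"
proof -
  have "holonomy_map b c `` U = (\<lambda>p. (c, box_proj c p)) ` ({p \<in> box_dom b. (b, box_proj b p) \<in> U} \<inter> box_dom c)"
    by (auto simp: holonomy_map_def)
  then show ?thesis
    using openin_holonomy_space_image[OF assms(2,4) openin_holonomy_space_vimage[OF assms(1,3,5)]] by simp
qed

lemma single_valued_holonomy_map:
  assumes "regular_atlas k X \<B>" "b \<in> \<B>" "c \<in> \<B>"
  shows "single_valued (holonomy_map b c)"
  unfolding single_valued_def holonomy_map_def
  by clarsimp (rule regular_atlas_holonomy_functional[OF assms]; simp)

lemma open_partial_bijection_holonomy_map:
  assumes reg: "regular_atlas k X \<B>" and bc: "b \<in> \<B>" "c \<in> \<B>"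
  shows "open_partial_bijection (holonomy_space \<B>) (holonomy_map b c)"
  unfolding open_partial_bijection_def converse_holonomy_map
proof (intro conjI allI impI)
  have fb: "is_flow_box X b" "is_flow_box X c"
    using reg bc by (auto simp: regular_atlas_def foliated_atlas_def)
  show "holonomy_map b c \<subseteq> topspace (holonomy_space \<B>) \<times> topspace (holonomy_space \<B>)"
    using bc box_proj_in_topspace[OF fb(1)] box_proj_in_topspace[OF fb(2)]
    by (auto simp: holonomy_map_def holonomy_space_def)
  show "single_valued (holonomy_map b c)" "single_valued (holonomy_map c b)"
    using single_valued_holonomy_map[OF reg] bc by auto
  fix U assume "openin (holonomy_space \<B>) U"
  then show "openin (holonomy_space \<B>) (holonomy_map b c `` U)"
    "openin (holonomy_space \<B>) (holonomy_map c b `` U)"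
    using openin_holonomy_map_image fb bc by blast+
qed

text \<open>Read at a single point, quasi-local equality compares neighborhoods: a ball small enough
  to lie in the comparison set, of radius at most \<open>\<delta> \<epsilon>\<close>, fits into the
  ball of the other metric.\<close>

lemma quasi_locally_equal_cover_ball:
  assumes "quasi_locally_equal_cover Z Q" "m \<in> Q" "m' \<in> Q" "z \<in> mspace m" "z \<in> mspace m'" "\<epsilon> > 0"
  obtains \<eta> where "\<eta> > 0" "mball_of m z \<eta> \<subseteq> mball_of m' z \<epsilon>"
proof -
  obtain \<delta> :: "real \<Rightarrow> real" where \<delta>: "\<forall>\<epsilon>>0. \<delta> \<epsilon> > 0"
    and loc: "\<forall>m\<in>Q. \<forall>m'\<in>Q. \<forall>z \<in> mspace m \<inter> mspace m'.
        \<exists>U. openin (mtopology_of m) U \<and> z \<in> U \<and> U \<subseteq> mspace m \<inter> mspace m' \<and>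
          (\<forall>\<epsilon>>0. \<forall>x\<in>U. \<forall>y\<in>U. mdist m x y < \<delta> \<epsilon> \<longrightarrow> mdist m' x y < \<epsilon>)"
    using assms(1) unfolding quasi_locally_equal_cover_def by (elim exE conjE)
  from bspec[OF bspec[OF bspec[OF loc assms(2)] assms(3)] IntI[OF assms(4,5)]]
  obtain U where U: "openin (mtopology_of m) U" "z \<in> U" "U \<subseteq> mspace m \<inter> mspace m'"
    and dist: "\<forall>\<epsilon>>0. \<forall>x\<in>U. \<forall>y\<in>U. mdist m x y < \<delta> \<epsilon> \<longrightarrow> mdist m' x y < \<epsilon>"
    by (elim exE conjE)
  obtain r where r: "r > 0" "mball_of m z r \<subseteq> U"
    using U(1,2) Metric_space.openin_mtopology[OF Metric_space_mspace_mdist, of m]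
    unfolding mtopology_of_def mball_of_def by blast
  show thesis
  proof
    show "min r (\<delta> \<epsilon>) > 0"
      using r \<delta>(1) assms(6) by auto
    show "mball_of m z (min r (\<delta> \<epsilon>)) \<subseteq> mball_of m' z \<epsilon>"
    proof
      fix x assume "x \<in> mball_of m z (min r (\<delta> \<epsilon>))"
      then have "x \<in> U" "mdist m z x < \<delta> \<epsilon>"
        using r(2) by auto
      then show "x \<in> mball_of m' z \<epsilon>"
        using dist U(2,3) assms(5,6) by auto
    qed
  qed
qed

section \<open>The induced topology seen from one representative of the quasi-local metric\<close>

context
  fixes T :: "'z topology" and \<QQ> :: "'z metric set set" and Q :: "'z metric set"
  assumes qm: "quasi_local_metric (topspace T) \<QQ>" and ind: "induces_topology \<QQ> T" and Q: "Q \<in> \<QQ>"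
begin

lemma quasi_local_metric_Union_mspace: "(\<Union>m\<in>Q. mspace m) = topspace T"
proof -
  have "quasi_locally_equal_cover (topspace T) Q"
    using qm Q unfolding quasi_local_metric_def quasi_local_equivalence_def by (auto elim!: quotientE)
  then show ?thesis
    by (simp add: quasi_locally_equal_cover_def)
qed

lemma openin_mball_of:
  assumes m: "m \<in> Q"
  shows "openin T (mball_of m x r)"
proof (cases "x \<in> mspace m \<and> r > 0")
  case True
  then have "(arbitrary union_of (\<lambda>B. \<exists>Q\<in>\<QQ>. \<exists>m\<in>Q. \<exists>x\<in>mspace m. \<exists>r>0. B = mball_of m x r)) (mball_of m x r)"
    using m Q by (intro arbitrary_union_of_inc) blast
  then show ?thesis
    using ind unfolding induces_topology_def by simp
next
  case False
  have "y \<notin> mball_of m x r" for y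
    using False le_less_trans[OF mdist_nonneg[of m x y], of r] by auto
  then have "mball_of m x r = {}"
    by blast
  then show ?thesis
    by simp
qed

lemma openin_mspace:
  assumes m: "m \<in> Q"
  shows "openin T (mspace m)"
proof (subst openin_subopen, intro ballI)
  fix x assume x: "x \<in> mspace m"
  then have "mdist m x x = 0"
    by simp
  then have "mdist m x x < 1"
    by linarith
  with x have "x \<in> mball_of m x 1" "mball_of m x 1 \<subseteq> mspace m"
    by auto
  then show "\<exists>U. openin T U \<and> x \<in> U \<and> U \<subseteq> mspace m"
    using openin_mball_of[OF m] by blast
qed

text \<open>The base of the topology consists of balls from all families of the class, so
  \<open>U\<close> first yields a ball of some \<open>m'\<close> in another family
  \<open>Q'\<close>. The metrics \<open>m\<close> and \<open>m'\<close> are compared through a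
  metric \<open>m0\<close> of the family \<open>Q0\<close> defining the class: its unions with
  \<open>Q\<close> and with \<open>Q'\<close> are covers by definition, so transitivity of the
  equivalence is avoided.\<close>

lemma mball_of_nhd_base:
  assumes m: "m \<in> Q" "u \<in> mspace m" and U: "openin T U" "u \<in> U"
  obtains \<eta> where "\<eta> > 0" "mball_of m u \<eta> \<subseteq> U"
proof -
  have "(arbitrary union_of (\<lambda>B. \<exists>Q\<in>\<QQ>. \<exists>m\<in>Q. \<exists>x\<in>mspace m. \<exists>r>0. B = mball_of m x r)) U"
    using U(1) ind unfolding induces_topology_def by simp
  then obtain \<U> where \<U>: "\<U> \<subseteq> {B. \<exists>Q\<in>\<QQ>. \<exists>m\<in>Q. \<exists>x\<in>mspace m. \<exists>r>0. B = mball_of m x r}" "\<Union>\<U> = U"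
    by (auto simp: union_of_def arbitrary_def)
  then obtain B where B: "B \<in> \<U>" "u \<in> B" "B \<subseteq> U"
    using U(2) by blast
  then obtain Q' m' x r where m': "Q' \<in> \<QQ>" "m' \<in> Q'" and "B = mball_of m' x r"
    using \<U>(1) by blast
  then have B: "u \<in> mball_of m' x r" "mball_of m' x r \<subseteq> U"
    using B by auto
  have r: "r - mdist m' x u > 0"
    using B(1) by simp
  have sub: "mball_of m' u (r - mdist m' x u) \<subseteq> U"
  proof
    fix y assume y: "y \<in> mball_of m' u (r - mdist m' x u)"
    then have "mdist m' x y < r"
      using mdist_triangle[of x m' u y] B(1) by auto
    then show "y \<in> U"
      using B y by auto
  qed
  obtain Q0 where Q0: "quasi_locally_equal_cover (topspace T) Q0"
    and \<QQ>: "\<QQ> = quasi_local_equivalence (topspace T) `` {Q0}"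
    using qm unfolding quasi_local_metric_def by (auto elim!: quotientE)
  have cov: "quasi_locally_equal_cover (topspace T) (Q0 \<union> P)" if "P \<in> \<QQ>" for P
    using that \<QQ> by (auto simp: quasi_local_equivalence_def)
  have "u \<in> topspace T"
    using U openin_subset by blast
  then obtain m0 where m0: "m0 \<in> Q0" "u \<in> mspace m0"
    using Q0 unfolding quasi_locally_equal_cover_def by blast
  have "m0 \<in> Q0 \<union> Q'" "m' \<in> Q0 \<union> Q'" "u \<in> mspace m'"
    using m0 m' B(1) by auto
  from quasi_locally_equal_cover_ball[OF cov[OF m'(1)] this(1,2) m0(2) this(3) r]
  obtain \<eta>0 where \<eta>0: "\<eta>0 > 0" "mball_of m0 u \<eta>0 \<subseteq> mball_of m' u (r - mdist m' x u)" .
  have "m \<in> Q0 \<union> Q" "m0 \<in> Q0 \<union> Q"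
    using m0 m by auto
  from quasi_locally_equal_cover_ball[OF cov[OF Q] this m(2) m0(2) \<eta>0(1)]
  obtain \<eta> where "\<eta> > 0" "mball_of m u \<eta> \<subseteq> mball_of m0 u \<eta>0" .
  then show thesis
    using that \<eta>0 sub by blast
qed

end

section \<open>Closures of leaves\<close>

lemma finite_uniform_positive:
  fixes R :: "'i \<Rightarrow> real \<Rightarrow> bool"
  assumes "finite I" and "\<And>i. i \<in> I \<Longrightarrow> \<exists>\<eta>>0. R i \<eta>"
    and anti: "\<And>i \<eta> \<eta>'. R i \<eta> \<Longrightarrow> 0 < \<eta>' \<Longrightarrow> \<eta>' \<le> \<eta> \<Longrightarrow> R i \<eta>'"
  shows "\<exists>\<eta>>0. \<forall>i\<in>I. R i \<eta>"
proof -
  obtain e where e: "\<And>i. i \<in> I \<Longrightarrow> e i > 0 \<and> R i (e i)"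
    using assms(2) by metis
  \<comment> \<open>The extra 1 keeps the minimum defined when \<open>I\<close> is empty.\<close>
  define \<eta> where "\<eta> = Min (insert 1 (e ` I))"
  have pos: "\<eta> > 0"
    using assms(1) e by (auto simp: \<eta>_def)
  have le: "\<eta> \<le> e i" if "i \<in> I" for i
    using assms(1) that by (auto simp: \<eta>_def intro: Min_le)
  have "R i \<eta>" if "i \<in> I" for i
    using anti e[OF that] pos le[OF that] by blast
  then show ?thesis
    using pos by blast
qed

text \<open>The Lebesgue number argument in abstract form: a constant that works locally uniformly
  and may always be decreased works on a whole compact set.\<close>

lemma compactin_uniform_positive:
  fixes R :: "'a \<Rightarrow> real \<Rightarrow> bool"
  assumes K: "compactin X K"
    and loc: "\<And>p. p \<in> K \<Longrightarrow> \<exists>N \<eta>. openin X N \<and> p \<in> N \<and> \<eta> > 0 \<and> (\<forall>x\<in>N \<inter> K. R x \<eta>)"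
    and anti: "\<And>x \<eta> \<eta>'. R x \<eta> \<Longrightarrow> 0 < \<eta>' \<Longrightarrow> \<eta>' \<le> \<eta> \<Longrightarrow> R x \<eta>'"
  shows "\<exists>\<eta>>0. \<forall>x\<in>K. R x \<eta>"
proof -
  define \<N> where "\<N> = {N. openin X N \<and> (\<exists>\<eta>>0. \<forall>x\<in>N \<inter> K. R x \<eta>)}"
  have "\<forall>N\<in>\<N>. openin X N" "K \<subseteq> \<Union>\<N>"
    using loc unfolding \<N>_def by blast+
  then obtain \<F> where \<F>: "finite \<F>" "\<F> \<subseteq> \<N>" "K \<subseteq> \<Union>\<F>"
    using K unfolding compactin_def by meson
  have "\<exists>\<eta>>0. \<forall>N\<in>\<F>. \<forall>x\<in>N \<inter> K. R x \<eta>"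
  proof (rule finite_uniform_positive[OF \<F>(1)])
    show "\<exists>\<eta>>0. \<forall>x\<in>N \<inter> K. R x \<eta>" if "N \<in> \<F>" for N
      using that \<F>(2) unfolding \<N>_def by blast
    show "\<forall>x\<in>N \<inter> K. R x \<eta>'" if "\<forall>x\<in>N \<inter> K. R x \<eta>" "0 < \<eta>'" "\<eta>' \<le> \<eta>" for N \<eta> \<eta>'
      using anti that by blast
  qed
  then show ?thesis
    using \<F>(3) by blast
qed

text \<open>The class of the quasi-local metric and the generation of the pseudogroup are replaced
  by their consequences: each metric of \<open>Q\<close> recovers the topology near its points, and
  holonomy maps have germs in \<open>S\<close> or the identity.\<close>

locale equicontinuous_atlas =
  fixes k :: enat and X :: "'a topology" and \<B> :: "('a, 'n::finite, 'z) flow_box set"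
    and Q :: "(('a, 'n, 'z) flow_box \<times> 'z) metric set"
    and S :: "((('a, 'n, 'z) flow_box \<times> 'z) \<times> (('a, 'n, 'z) flow_box \<times> 'z)) set set"
  assumes regular_atlas: "regular_atlas k X \<B>"
    and compact: "compact_space X" and regular: "regular_space X"
    and Union_mspace: "(\<Union>m\<in>Q. mspace m) = topspace (holonomy_space \<B>)"
    and open_ball: "\<And>m x r. m \<in> Q \<Longrightarrow> openin (holonomy_space \<B>) (mball_of m x r)"
    and open_mspace: "\<And>m. m \<in> Q \<Longrightarrow> openin (holonomy_space \<B>) (mspace m)"
    and ball_base: "\<And>m u U. m \<in> Q \<Longrightarrow> u \<in> mspace m \<Longrightarrow> openin (holonomy_space \<B>) U \<Longrightarrow> u \<in> U \<Longrightarrow>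
      \<exists>\<eta>>0. mball_of m u \<eta> \<subseteq> U"
    and partial_bijection: "\<And>s. s \<in> S \<Longrightarrow> open_partial_bijection (holonomy_space \<B>) s"
    and comp: "\<And>g h. g \<in> S \<Longrightarrow> h \<in> S \<Longrightarrow> g O h \<in> S"
    and germ: "\<And>b c u v. b \<in> \<B> \<Longrightarrow> c \<in> \<B> \<Longrightarrow> (u, v) \<in> holonomy_map b c \<Longrightarrow>
      \<exists>s\<in>insert (Id_on (topspace (holonomy_space \<B>))) S. \<exists>U. openin (holonomy_space \<B>) U \<and> u \<in> U \<and>
        (u, v) \<in> s \<and> s \<inter> (U \<times> UNIV) \<subseteq> holonomy_map b c"
    and equicontinuous: "\<And>\<epsilon>. \<epsilon> > 0 \<Longrightarrow> \<exists>\<delta>>0. \<forall>h\<in>S. \<forall>m\<in>Q. \<forall>m'\<in>Q. \<forall>x y x' y'.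
      (x, x') \<in> h \<and> (y, y') \<in> h \<and> x \<in> mspace m \<and> y \<in> mspace m \<and>
      x' \<in> mspace m' \<and> y' \<in> mspace m' \<and> mdist m x y < \<delta> \<longrightarrow> mdist m' x' y' < \<epsilon>"
begin

section \<open>Finite covers and Lebesgue numbers for holonomy maps\<close>

abbreviation "T \<equiv> holonomy_space \<B>"

abbreviation "S\<^sub>1 \<equiv> insert (Id_on (topspace T)) S"

definition \<tau> :: "('a, 'n, 'z) flow_box \<Rightarrow> 'a \<Rightarrow> ('a, 'n, 'z) flow_box \<times> 'z"
  where "\<tau> b p = (b, box_proj b p)"

lemma atlas: "foliated_atlas k X \<B>"
  using regular_atlas by (simp add: regular_atlas_def)

lemma flow_box: "b \<in> \<B> \<Longrightarrow> is_flow_box X b"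
  using atlas by (simp add: foliated_atlas_def)

lemma openin_vimage_\<tau>: "b \<in> \<B> \<Longrightarrow> openin T U \<Longrightarrow> openin X {p \<in> box_dom b. \<tau> b p \<in> U}"
  unfolding \<tau>_def using openin_holonomy_space_vimage flow_box by blast

lemma openin_image_\<tau>: "b \<in> \<B> \<Longrightarrow> openin X W \<Longrightarrow> openin T (\<tau> b ` (W \<inter> box_dom b))"
  unfolding \<tau>_def using openin_holonomy_space_image flow_box by blast

lemma partial_bijection\<^sub>1: "s \<in> S\<^sub>1 \<Longrightarrow> open_partial_bijection T s"
  using partial_bijection open_partial_bijection_Id_on by blast

lemma comp\<^sub>1:
  assumes "g \<in> S\<^sub>1" "h \<in> S\<^sub>1"
  shows "g O h \<in> S\<^sub>1"
proof -
  have "Id_on (topspace T) O s = s" "s O Id_on (topspace T) = s" if "s \<in> S\<^sub>1" for s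
    using partial_bijection\<^sub>1[OF that] by (auto simp: open_partial_bijection_def)
  note Id = this[OF assms(1)] this[OF assms(2)]
  show ?thesis
    using assms comp Id by auto
qed

lemma leaf_closed: "L \<in> leaves X \<B> \<Longrightarrow> b \<in> \<B> \<Longrightarrow> p \<in> L \<Longrightarrow> p \<in> box_dom b \<Longrightarrow> q \<in> box_dom b \<Longrightarrow>
    \<tau> b q = \<tau> b p \<Longrightarrow> q \<in> L"
  using leaf_plaque_closed[OF atlas] by (simp add: \<tau>_def)

text \<open>The open sets \<open>V\<close> are for covering \<open>X\<close>; the closed sets
  \<open>C\<close> are for uniformity. Overlaps of boxes are not compact, but in a compact space the
  intersections of the sets \<open>C\<close> are, and they stay within the boxes and within the
  domains of the metrics.\<close>

definition charts where
  "charts = {(b, m, V, C). b \<in> \<B> \<and> m \<in> Q \<and> openin X V \<and> closedin X C \<and> V \<subseteq> C \<and>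
    C \<subseteq> {x \<in> box_dom b. \<tau> b x \<in> mspace m}}"

lemma chartsD:
  assumes "(b, m, V, C) \<in> charts"
  shows "b \<in> \<B>" "m \<in> Q" "openin X V" "closedin X C" "V \<subseteq> C"
    and "x \<in> C \<Longrightarrow> x \<in> box_dom b" "x \<in> C \<Longrightarrow> \<tau> b x \<in> mspace m"
  using assms unfolding charts_def by blast+

lemma ex_chart:
  assumes p: "p \<in> topspace X"
  shows "\<exists>b m V C. (b, m, V, C) \<in> charts \<and> p \<in> V"
proof -
  obtain b where b: "b \<in> \<B>" "p \<in> box_dom b"
    using p atlas unfolding foliated_atlas_def by blast
  have "\<tau> b p \<in> topspace T"
    using b box_proj_in_topspace[OF flow_box[OF b(1)] b(2)] by (simp add: \<tau>_def holonomy_space_def)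
  then obtain m where m: "m \<in> Q" "\<tau> b p \<in> mspace m"
    using Union_mspace by blast
  have "neighbourhood_base_of (closedin X) X"
    using regular by (simp add: neighbourhood_base_of_closedin)
  moreover have "openin X {x \<in> box_dom b. \<tau> b x \<in> mspace m}" "p \<in> {x \<in> box_dom b. \<tau> b x \<in> mspace m}"
    using openin_vimage_\<tau>[OF b(1) open_mspace[OF m(1)]] b m by auto
  ultimately obtain V C where "openin X V" "closedin X C" "p \<in> V" "V \<subseteq> C"
      "C \<subseteq> {x \<in> box_dom b. \<tau> b x \<in> mspace m}"
    unfolding neighbourhood_base_of by meson
  then show ?thesis
    using b m unfolding charts_def by blast
qed

lemma ex_finite_cover:
  obtains I where "finite I" "I \<subseteq> charts" "\<And>x. x \<in> topspace X \<Longrightarrow> \<exists>b m V C. (b, m, V, C) \<in> I \<and> x \<in> V"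
proof -
  let ?V = "\<lambda>(b, m, V, C). V"
  have "\<forall>U\<in>?V ` charts. openin X U"
    using chartsD(3) by fastforce
  moreover have "topspace X \<subseteq> \<Union> (?V ` charts)"
    using ex_chart by fastforce
  ultimately obtain \<F> where \<F>: "finite \<F>" "\<F> \<subseteq> ?V ` charts" "topspace X \<subseteq> \<Union>\<F>"
    using compact unfolding compact_space_alt by meson
  obtain I where I: "I \<subseteq> charts" "finite I" "\<F> = ?V ` I"
    using finite_subset_image[OF \<F>(1,2)] by blast
  show thesis
  proof (rule that[OF I(2,1)])
    show "\<exists>b m V C. (b, m, V, C) \<in> I \<and> x \<in> V" if x: "x \<in> topspace X" for x
    proof -
      obtain i where "i \<in> I" "x \<in> ?V i"
        using x \<F>(3) unfolding I(3) by blast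
      then show ?thesis
        by (cases i) auto
    qed
  qed
qed

text \<open>
  A Lebesgue number: a point that is \<open>\<eta>\<close>-close to \<open>\<tau> b x\<close> is still in the domain of the holonomy
  map from \<open>b\<close> to \<open>c\<close>, and a single element of \<open>S\<^sub>1\<close> represents that map at both points.
\<close>

definition follows where
  "follows b m c m' x \<eta> \<longleftrightarrow> (\<forall>w\<in>mspace m. mdist m (\<tau> b x) w < \<eta> \<longrightarrow>
    (\<exists>s\<in>S\<^sub>1. \<exists>y\<in>box_dom b \<inter> box_dom c. w = \<tau> b y \<and> (\<tau> b x, \<tau> c x) \<in> s \<and> (w, \<tau> c y) \<in> s \<and> \<tau> c y \<in> mspace m'))"

text \<open>One germ at \<open>p\<close> represents the holonomy map on an entire ball about
  \<open>\<tau> b p\<close>, and half of its radius then works for all points that project into the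
  concentric ball of half the radius.\<close>

lemma follows_local:
  assumes bc: "b \<in> \<B>" "c \<in> \<B>" and m: "m \<in> Q" "m' \<in> Q"
    and p: "p \<in> box_dom b \<inter> box_dom c" "\<tau> b p \<in> mspace m" "\<tau> c p \<in> mspace m'"
  shows "\<exists>N \<eta>. openin X N \<and> p \<in> N \<and> \<eta> > 0 \<and> (\<forall>x\<in>N \<inter> box_dom c. follows b m c m' x \<eta>)"
proof -
  \<comment> \<open>Regularity pins the value at \<open>\<tau> b x\<close> to
    \<open>\<tau> c x\<close>, although \<open>holonomy_map\<close> is defined through arbitrary
    points of the plaque.\<close>
  have hol: "(\<tau> b x, v) \<in> holonomy_map b c \<longleftrightarrow> x \<in> box_dom c \<and> v = \<tau> c x" if x: "x \<in> box_dom b \<inter> box_dom c" for x v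
  proof
    assume "(\<tau> b x, v) \<in> holonomy_map b c"
    then obtain y where y: "y \<in> box_dom b \<inter> box_dom c" "box_proj b x = box_proj b y" "v = \<tau> c y"
      by (auto simp: holonomy_map_def \<tau>_def)
    then show "x \<in> box_dom c \<and> v = \<tau> c x"
      using regular_atlas_holonomy_functional[OF regular_atlas bc x y(1,2)] x by (simp add: \<tau>_def)
  next
    assume "x \<in> box_dom c \<and> v = \<tau> c x"
    then show "(\<tau> b x, v) \<in> holonomy_map b c"
      using x by (auto simp: holonomy_map_def \<tau>_def)
  qed
  have "(\<tau> b p, \<tau> c p) \<in> holonomy_map b c"
    using hol p by blast
  from germ[OF bc this] obtain s U where s: "s \<in> S\<^sub>1" "openin T U" "\<tau> b p \<in> U"
      "(\<tau> b p, \<tau> c p) \<in> s" "s \<inter> (U \<times> UNIV) \<subseteq> holonomy_map b c"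
    by (elim bexE exE conjE)
  \<comment> \<open>The intersection forces the images under \<open>s\<close> into the domain of
    \<open>m'\<close>.\<close>
  let ?U = "U \<inter> converse s `` mspace m'"
  have "openin T ?U"
    using s(2) partial_bijection\<^sub>1[OF s(1)] open_mspace[OF m(2)]
    unfolding open_partial_bijection_def by blast
  moreover have "\<tau> b p \<in> ?U"
    using s(3,4) p(3) by blast
  ultimately obtain r where r: "r > 0" "mball_of m (\<tau> b p) r \<subseteq> ?U"
    using ball_base[OF m(1) p(2)] by blast
  \<comment> \<open>With \<open>x\<close> and \<open>w\<close> each contributing less than
    \<open>r / 2\<close>, both \<open>\<tau> b x\<close> and \<open>w\<close> lie in the ball of
    radius \<open>r\<close>, where the same \<open>s\<close> applies.\<close>
  let ?N = "{x \<in> box_dom b. \<tau> b x \<in> mball_of m (\<tau> b p) (r / 2)}"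
  have "openin X ?N"
    using openin_vimage_\<tau>[OF bc(1) open_ball[OF m(1)]] .
  moreover have "p \<in> ?N"
  proof -
    have "mdist m (\<tau> b p) (\<tau> b p) = 0"
      using p(2) by simp
    then have "mdist m (\<tau> b p) (\<tau> b p) < r / 2"
      using r(1) by linarith
    then show ?thesis
      using p by simp
  qed
  moreover have "follows b m c m' x (r / 2)" if x: "x \<in> ?N \<inter> box_dom c" for x
    unfolding follows_def
  proof (intro ballI impI)
    fix w assume w: "w \<in> mspace m" "mdist m (\<tau> b x) w < r / 2"
    have "mdist m (\<tau> b p) w \<le> mdist m (\<tau> b p) (\<tau> b x) + mdist m (\<tau> b x) w"
      using x w by (intro mdist_triangle) auto
    then have "w \<in> mball_of m (\<tau> b p) r"
      using x w by auto
    then obtain w' where w': "w \<in> U" "(w, w') \<in> s" "w' \<in> mspace m'"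
      using r(2) by blast
    then have "(w, w') \<in> holonomy_map b c"
      using s(5) by blast
    then obtain y where y: "y \<in> box_dom b \<inter> box_dom c" "w = \<tau> b y" "w' = \<tau> c y"
      by (auto simp: holonomy_map_def \<tau>_def)
    have "\<tau> b x \<in> mball_of m (\<tau> b p) r"
      using x r(1) by auto
    then obtain v where v: "\<tau> b x \<in> U" "(\<tau> b x, v) \<in> s"
      using r(2) by blast
    then have "(\<tau> b x, v) \<in> holonomy_map b c"
      using s(5) by blast
    then have "(\<tau> b x, \<tau> c x) \<in> s"
      using hol[of x v] x v(2) by blast
    moreover have "(w, \<tau> c y) \<in> s" "\<tau> c y \<in> mspace m'"
      using w' y by auto
    ultimately show "\<exists>s\<in>S\<^sub>1. \<exists>y\<in>box_dom b \<inter> box_dom c. w = \<tau> b y \<and> (\<tau> b x, \<tau> c x) \<in> s \<and> (w, \<tau> c y) \<in> s \<and>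
        \<tau> c y \<in> mspace m'"
      using s(1) y(1,2) by (intro bexI[of _ s] bexI[of _ y] conjI)
  qed
  ultimately show ?thesis
    using half_gt_zero[OF r(1)] by blast
qed

lemma follows_uniform:
  assumes bc: "b \<in> \<B>" "c \<in> \<B>" and m: "m \<in> Q" "m' \<in> Q" and K: "closedin X K"
    and sub: "\<And>x. x \<in> K \<Longrightarrow> x \<in> box_dom b \<inter> box_dom c \<and> \<tau> b x \<in> mspace m \<and> \<tau> c x \<in> mspace m'"
  shows "\<exists>\<eta>>0. \<forall>x\<in>K. follows b m c m' x \<eta>"
proof -
  have "compactin X K"
    using compact K closedin_compact_space by blast
  then show ?thesis
  proof (rule compactin_uniform_positive)
    fix p assume "p \<in> K"
    then obtain N \<eta> where "openin X N" "p \<in> N" "\<eta> > 0" "\<forall>x\<in>N \<inter> box_dom c. follows b m c m' x \<eta>"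
      using follows_local[OF bc m] sub by blast
    then show "\<exists>N \<eta>. openin X N \<and> p \<in> N \<and> \<eta> > 0 \<and> (\<forall>x\<in>N \<inter> K. follows b m c m' x \<eta>)"
      using sub by blast
  next
    show "follows b m c m' x \<eta>'" if "follows b m c m' x \<eta>" "\<eta>' \<le> \<eta>" for x \<eta> \<eta>'
      using that unfolding follows_def by fastforce
  qed
qed

end

section \<open>Following one leaf while staying close to another\<close>

context equicontinuous_atlas
begin

text \<open>Accumulation becomes a symmetric relation between leaves. Without equicontinuity this
  fails: in a Reeb component the interior leaves accumulate on the compact boundary leaf, but not
  conversely.\<close>

lemma leaf_subset_closure_of_approached_leaf:
  assumes L: "L \<in> leaves X \<B>" and L': "L' \<in> leaves X \<B>"
    and q: "q \<in> L'" "q \<in> X closure_of L"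
  shows "L \<subseteq> X closure_of L'"
proof
  fix p assume pL: "p \<in> L"
  then have p: "p \<in> topspace X"
    using leaf_subset_topspace[OF atlas L] by blast
  have "\<exists>y. y \<in> L' \<and> y \<in> W" if W: "p \<in> W" "openin X W" for W
  proof -
    obtain I where I: "finite I" "I \<subseteq> charts"
      and cover: "\<And>x. x \<in> topspace X \<Longrightarrow> \<exists>b m V C. (b, m, V, C) \<in> I \<and> x \<in> V"
      using ex_finite_cover by metis
    obtain b1 m1 V1 C1 where i1: "(b1, m1, V1, C1) \<in> I" "p \<in> V1"
      using cover[OF p] by (elim exE conjE)
    have chart1: "(b1, m1, V1, C1) \<in> charts"
      using i1 I by blast
    have p1: "p \<in> box_dom b1" "\<tau> b1 p \<in> mspace m1"
      using i1 chartsD[OF chart1] by blast+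
    \<comment> \<open>A transverse coordinate within \<open>\<epsilon>1\<close> of
      \<open>\<tau> b1 p\<close> belongs to a plaque that meets \<open>W\<close>, so bringing
      \<open>L'\<close> that close is enough.\<close>
    have "openin T (\<tau> b1 ` (W \<inter> box_dom b1))" "\<tau> b1 p \<in> \<tau> b1 ` (W \<inter> box_dom b1)"
      using openin_image_\<tau>[OF chartsD(1)[OF chart1] W(2)] W(1) p1 by auto
    from ball_base[OF chartsD(2)[OF chart1] p1(2) this]
    obtain \<epsilon>1 where \<epsilon>1: "\<epsilon>1 > 0" "mball_of m1 (\<tau> b1 p) \<epsilon>1 \<subseteq> \<tau> b1 ` (W \<inter> box_dom b1)"
      by (elim exE conjE)

    have "\<exists>\<eta>>0. \<forall>ij\<in>I \<times> I. case ij of ((b, m, V, C), (c, m', V', C')) \<Rightarrow>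
        \<forall>x\<in>C \<inter> C'. follows b m c m' x \<eta>"
    proof (rule finite_uniform_positive, goal_cases)
      case 1
      show ?case
        using I(1) by simp
    next
      case (2 ij)
      obtain b m V C c m' V' C' where ij: "ij = ((b, m, V, C), (c, m', V', C'))"
        by (metis prod.exhaust)
      then have charts: "(b, m, V, C) \<in> charts" "(c, m', V', C') \<in> charts"
        using 2 I(2) by auto
      have "\<exists>\<eta>>0. \<forall>x\<in>C \<inter> C'. follows b m c m' x \<eta>"
      proof (rule follows_uniform)
        show "closedin X (C \<inter> C')"
          using chartsD(4)[OF charts(1)] chartsD(4)[OF charts(2)] by blast
      qed (use chartsD[OF charts(1)] chartsD[OF charts(2)] in auto)
      then show ?case
        by (simp add: ij)
    next
      case (3 ij \<eta> \<eta>')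
      then show ?case
        unfolding follows_def by (fastforce split: prod.splits)
    qed
    then obtain \<eta> where \<eta>: "\<eta> > 0" "\<And>b m V C c m' V' C' x. (b, m, V, C) \<in> I \<Longrightarrow> (c, m', V', C') \<in> I \<Longrightarrow>
        x \<in> C \<inter> C' \<Longrightarrow> follows b m c m' x \<eta>"
      by fast

    \<comment> \<open>The bound by \<eta> lets the next holonomy map be applied at every stage; the
      bound by \<open>\<epsilon>1\<close> makes \<open>L'\<close> meet \<open>W\<close> at the
      end.\<close>
    define \<epsilon> where "\<epsilon> = min \<epsilon>1 \<eta>"
    have \<epsilon>: "\<epsilon> > 0"
      using \<epsilon>1(1) \<eta>(1) by (simp add: \<epsilon>_def)
    from equicontinuous[OF this] obtain \<delta> where \<delta>: "\<delta> > 0"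
      and eq: "\<forall>h\<in>S. \<forall>m\<in>Q. \<forall>m'\<in>Q. \<forall>x y x' y'.
      (x, x') \<in> h \<and> (y, y') \<in> h \<and> x \<in> mspace m \<and> y \<in> mspace m \<and>
      x' \<in> mspace m' \<and> y' \<in> mspace m' \<and> mdist m x y < \<delta> \<longrightarrow> mdist m' x' y' < \<epsilon>"
      by (elim exE conjE)

    have "q \<in> topspace X"
      using q leaf_subset_topspace[OF atlas L'] by blast
    from cover[OF this] obtain b0 m0 V0 C0 where i0: "(b0, m0, V0, C0) \<in> I" "q \<in> V0"
      by (elim exE conjE)
    have chart0: "(b0, m0, V0, C0) \<in> charts"
      using i0 I by blast
    have q0: "q \<in> box_dom b0" "\<tau> b0 q \<in> mspace m0"
      using i0 chartsD[OF chart0] by blast+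

    text \<open>
      If the germ that carries \<open>x0\<close> along the leaf is the identity, equicontinuity of \<open>S\<close> says nothing
      (\<open>S\<close> need not contain the identity), so \<open>x0\<close> is taken close to \<open>q\<close> in all metrics of the cover.
    \<close>
    define M where "M = {m \<in> (\<lambda>(b, m, V, C). m) ` I. \<tau> b0 q \<in> mspace m}"
    have M: "finite M" "m0 \<in> M" "M \<subseteq> Q"
    proof -
      show "finite M"
        using I(1) by (simp add: M_def)
      show "m0 \<in> M"
        using i0(1) q0(2) by (force simp: M_def)
      show "M \<subseteq> Q"
        using I(2) by (auto simp: M_def charts_def)
    qed
    \<comment> \<open>The bound by \<delta> feeds equicontinuity of \<open>S\<close>; the bound by
      \<epsilon> gives the starting value \<open>P0\<close> and the case of the identity.\<close>
    let ?U = "\<Inter>m\<in>M. mball_of m (\<tau> b0 q) (min \<delta> \<epsilon>)"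
    have "openin T (mball_of m (\<tau> b0 q) (min \<delta> \<epsilon>))" if "m \<in> M" for m
      using open_ball M(3) that by blast
    then have U: "openin T ?U"
      using M(1,2) by (intro openin_Inter) auto
    define N where "N = V0 \<inter> {x \<in> box_dom b0. \<tau> b0 x \<in> ?U}"
    have "openin X N"
      unfolding N_def
      using openin_vimage_\<tau>[OF chartsD(1)[OF chart0] U] chartsD(3)[OF chart0] by blast
    moreover have "q \<in> N"
    proof -
      have "\<tau> b0 q \<in> mball_of m (\<tau> b0 q) (min \<delta> \<epsilon>)" if "m \<in> M" for m
      proof -
        have "\<tau> b0 q \<in> mspace m"
          using that by (simp add: M_def)
        moreover from this have "mdist m (\<tau> b0 q) (\<tau> b0 q) = 0"
          by simp
        then have "mdist m (\<tau> b0 q) (\<tau> b0 q) < min \<delta> \<epsilon>"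
          using \<delta> \<epsilon> by linarith
        ultimately show ?thesis
          by simp
      qed
      then show ?thesis
        using i0(2) q0(1) unfolding N_def by blast
    qed
    ultimately obtain x0 where "x0 \<in> L" "x0 \<in> N"
      using q(2) unfolding in_closure_of by blast
    then have x0: "x0 \<in> L" "x0 \<in> V0" "x0 \<in> box_dom b0" "\<tau> b0 x0 \<in> ?U"
      unfolding N_def by blast+
    have near: "\<tau> b0 x0 \<in> mspace m \<and> mdist m (\<tau> b0 x0) (\<tau> b0 q) < \<delta> \<and> mdist m (\<tau> b0 x0) (\<tau> b0 q) < \<epsilon>"
      if "m \<in> M" for m
    proof -
      have "\<tau> b0 x0 \<in> mball_of m (\<tau> b0 q) (min \<delta> \<epsilon>)"
        using x0(4) that by blast
      then show ?thesis
        by (simp add: mdist_commute)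
    qed

    text \<open>
      \<open>P x b m\<close>: the holonomy that carries \<open>x0\<close> to \<open>x\<close> along \<open>L\<close> also carries \<open>q\<close> along \<open>L'\<close>, to a point
      that is still \<open>\<epsilon>\<close>-close. Having this property is locally constant along \<open>L\<close>.
    \<close>
    define P where "P x b m \<longleftrightarrow> (\<exists>y\<in>L' \<inter> box_dom b. \<exists>s\<in>S\<^sub>1. (\<tau> b0 x0, \<tau> b x) \<in> s \<and>
      (\<tau> b0 q, \<tau> b y) \<in> s \<and> \<tau> b y \<in> mspace m \<and> mdist m (\<tau> b x) (\<tau> b y) < \<epsilon>)" for x b m
    have P0: "P x0 b0 m0"
      unfolding P_def
    proof (intro bexI conjI)
      have "mspace m0 \<subseteq> topspace T"
        using Union_mspace M by blast
      then show "(\<tau> b0 x0, \<tau> b0 x0) \<in> Id_on (topspace T)" "(\<tau> b0 q, \<tau> b0 q) \<in> Id_on (topspace T)"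
        using near[OF M(2)] q0 by blast+
    qed (use near[OF M(2)] q0 q(1) in auto)

    \<comment> \<open>\<open>P x b m\<close> sees \<open>x\<close> only through
      \<open>\<tau> b x\<close>, so it already holds at \<open>x'\<close>. The real work is the
      change from chart \<open>b\<close> to chart \<open>c\<close> at \<open>x'\<close>, for which
      \<open>x'\<close> must lie in both.\<close>
    have step: "P x' c m'" if i: "(b, m, V, C) \<in> I" and j: "(c, m', V', C') \<in> I"
      and x: "x' \<in> V" "x' \<in> V'" "\<tau> b x = \<tau> b x'" "P x b m" for b m V C c m' V' C' x x'
    proof -
      have charts: "(b, m, V, C) \<in> charts" "(c, m', V', C') \<in> charts"
        using i j I by blast+
      have x': "x' \<in> C" "x' \<in> C'"
        using x charts[THEN chartsD(5)] by blast+
      obtain y s where y: "y \<in> L'" "y \<in> box_dom b" and s: "s \<in> S\<^sub>1"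
        "(\<tau> b0 x0, \<tau> b x') \<in> s" "(\<tau> b0 q, \<tau> b y) \<in> s"
        and d: "\<tau> b y \<in> mspace m" "mdist m (\<tau> b x') (\<tau> b y) < \<epsilon>"
        using x(4) unfolding P_def x(3) by (elim bexE conjE) (rule that, auto)
      have "mdist m (\<tau> b x') (\<tau> b y) < \<eta>"
        using d(2) by (simp add: \<epsilon>_def)
      moreover have "follows b m c m' x' \<eta>"
        using \<eta>(2)[OF i j] x' by blast
      ultimately have "\<exists>t\<in>S\<^sub>1. \<exists>y'\<in>box_dom b \<inter> box_dom c. \<tau> b y = \<tau> b y' \<and>
          (\<tau> b x', \<tau> c x') \<in> t \<and> (\<tau> b y, \<tau> c y') \<in> t \<and> \<tau> c y' \<in> mspace m'"
        unfolding follows_def using d(1) by simp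
      then obtain t y' where t: "t \<in> S\<^sub>1" and y': "y' \<in> box_dom b" "y' \<in> box_dom c" "\<tau> b y = \<tau> b y'"
        and tt: "(\<tau> b x', \<tau> c x') \<in> t" "(\<tau> b y, \<tau> c y') \<in> t" and y'm: "\<tau> c y' \<in> mspace m'"
        by (elim bexE conjE IntE)
      \<comment> \<open>\<open>y\<close> itself may lie outside \<open>box_dom c\<close>. Its
        replacement \<open>y'\<close> lies in the same plaque of \<open>b\<close>, hence still in
        \<open>L'\<close>.\<close>
      have yL: "y' \<in> L'"
        using leaf_closed[OF L' chartsD(1)[OF charts(1)] y y'(1)] y'(3) by simp
      have st: "s O t \<in> S\<^sub>1" "(\<tau> b0 x0, \<tau> c x') \<in> s O t" "(\<tau> b0 q, \<tau> c y') \<in> s O t"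
        using comp\<^sub>1[OF s(1) t] s(2,3) tt by blast+
      have m': "m' \<in> Q" "\<tau> c x' \<in> mspace m'"
        using chartsD(2,7)[OF charts(2)] x' by blast+
      \<comment> \<open>The estimate is made anew for the composite from the starting points
        \<open>x0\<close> and \<open>q\<close>, not derived from the distance at the previous stage,
        so \<epsilon> does not deteriorate.\<close>
      have "mdist m' (\<tau> c x') (\<tau> c y') < \<epsilon>"
      proof (cases "s O t \<in> S")
        case True
        then show ?thesis
          using eq[rule_format, OF True, of m0 m' "\<tau> b0 x0" "\<tau> c x'" "\<tau> b0 q" "\<tau> c y'"]
            st(2,3) m' y'm near[OF M(2)] q0(2) subsetD[OF M(3,2)] by blast
      next
        case False
        then have "\<tau> c x' = \<tau> b0 x0" "\<tau> c y' = \<tau> b0 q"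
          using st by auto
        moreover from this have "m' \<in> M"
          using j y'm by (force simp: M_def)
        ultimately show ?thesis
          using near by simp
      qed
      then show ?thesis
        unfolding P_def using yL y'(2) y'm st by (intro bexI[of _ y'] bexI[of _ "s O t"] conjI IntI)
    qed

    \<comment> \<open>Quantifying over all charts of the cover around \<open>x\<close> turns
      \<open>P\<close> into a property of the point alone, so that its propagation near a point may
      use whichever chart is at hand.\<close>
    define G where "G x \<longleftrightarrow> (\<forall>b m V C. (b, m, V, C) \<in> I \<longrightarrow> x \<in> V \<longrightarrow> P x b m)" for x
    have "G p"
    proof (rule leaf_induct[OF atlas L x0(1) _ pL])
      show "G x0"
        unfolding G_def by (intro allI impI) (rule step[OF i0(1) _ x0(2) _ refl P0])
      fix r assume "r \<in> L"
      then have "r \<in> topspace X"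
        using leaf_subset_topspace[OF atlas L] by blast
      from cover[OF this] obtain b m V C where i: "(b, m, V, C) \<in> I" "r \<in> V"
        by (elim exE conjE)
      have chart: "(b, m, V, C) \<in> charts"
        using i I by blast
      have "G y" if "x \<in> V" "y \<in> V" "\<tau> b x = \<tau> b y" "G x" for x y
      proof -
        have "P x b m"
          using that(1,4) i(1) unfolding G_def by blast
        then show ?thesis
          unfolding G_def by (intro allI impI) (rule step[OF i(1) _ that(2) _ that(3)])
      qed
      then have "\<forall>x\<in>L \<inter> V \<inter> box_dom b. \<forall>y\<in>L \<inter> V \<inter> box_dom b. box_proj b x = box_proj b y \<longrightarrow> G x \<longrightarrow> G y"
        by (intro ballI impI) (auto simp: \<tau>_def)
      moreover have "r \<in> box_dom b"
        using chartsD(5,6)[OF chart] i(2) by blast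
      ultimately show "\<exists>b\<in>\<B>. \<exists>W. r \<in> box_dom b \<and> openin X W \<and> r \<in> W \<and>
        (\<forall>x\<in>L \<inter> W \<inter> box_dom b. \<forall>y\<in>L \<inter> W \<inter> box_dom b. box_proj b x = box_proj b y \<longrightarrow> G x \<longrightarrow> G y)"
        using chartsD(1,3)[OF chart] i(2) by (intro bexI[of _ b] exI[of _ V] conjI)
    qed
    then have "P p b1 m1"
      using i1 unfolding G_def by blast
    then obtain y where y: "y \<in> L'" "y \<in> box_dom b1" "\<tau> b1 y \<in> mspace m1" "mdist m1 (\<tau> b1 p) (\<tau> b1 y) < \<epsilon>"
      unfolding P_def by blast
    then have "\<tau> b1 y \<in> mball_of m1 (\<tau> b1 p) \<epsilon>1"
      using p1(2) by (simp add: \<epsilon>_def)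
    then obtain y' where y': "y' \<in> W" "y' \<in> box_dom b1" "\<tau> b1 y = \<tau> b1 y'"
      using \<epsilon>1(2) by blast
    then have "y' \<in> L'"
      using leaf_closed[OF L' chartsD(1)[OF chart1] y(1,2) y'(2)] by simp
    then show ?thesis
      using y'(1) by blast
  qed
  then show "p \<in> X closure_of L'"
    using p unfolding in_closure_of by blast
qed

end

text \<open>The two descriptions of the holonomy pseudogroup are used in opposite directions:
  elements of \<open>S\<close> are open partial bijections because the holonomy maps generate them,
  and the holonomy maps have germs in \<open>S\<close> or the identity because \<open>S\<close>
  generates them.\<close>

lemma strongly_equicontinuous_imp_equicontinuous_atlas:
  assumes reg: "regular_atlas k X \<B>" and X: "compact_space X" "regular_space X"
    and se: "strongly_equicontinuous (holonomy_space \<B>) (holonomy_pseudogroup \<B>)"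
  obtains Q S where "equicontinuous_atlas k X \<B> Q S"
proof -
  let ?T = "holonomy_space \<B>"
  from se obtain \<QQ> Q S where \<QQ>: "quasi_local_metric (topspace ?T) \<QQ>" "induces_topology \<QQ> ?T" "Q \<in> \<QQ>"
    and S: "S \<subseteq> holonomy_pseudogroup \<B>" "generated_pseudogroup ?T S = holonomy_pseudogroup \<B>"
      "\<forall>h\<in>S. converse h \<in> S" "\<forall>g\<in>S. \<forall>h\<in>S. g O h \<in> S"
    and eq: "\<forall>\<epsilon>>0. \<exists>\<delta>>0. \<forall>h\<in>S. \<forall>m\<in>Q. \<forall>m'\<in>Q. \<forall>x y x' y'.
          (x, x') \<in> h \<and> (y, y') \<in> h \<and> x \<in> mspace m \<and> y \<in> mspace m \<and>
          x' \<in> mspace m' \<and> y' \<in> mspace m' \<and> mdist m x y < \<delta> \<longrightarrow> mdist m' x' y' < \<epsilon>"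
    unfolding strongly_equicontinuous_def by (elim exE bexE conjE)
  have bij: "open_partial_bijection ?T s" if "s \<in> S" for s
  proof (rule open_partial_bijection_generated_pseudogroup)
    show "s \<in> generated_pseudogroup ?T {holonomy_map b c | b c. b \<in> \<B> \<and> c \<in> \<B>}"
      using that S(1) by (auto simp: holonomy_pseudogroup_def)
  qed (use open_partial_bijection_holonomy_map[OF reg] in blast)
  have "equicontinuous_atlas k X \<B> Q S"
  proof
    show "regular_atlas k X \<B>" "compact_space X" "regular_space X"
      by fact+
    show "(\<Union>m\<in>Q. mspace m) = topspace ?T"
      by (rule quasi_local_metric_Union_mspace[OF \<QQ>])
    show "openin ?T (mball_of m x r)" if "m \<in> Q" for m x r
      by (rule openin_mball_of[OF \<QQ> that])
    show "openin ?T (mspace m)" if "m \<in> Q" for m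
      by (rule openin_mspace[OF \<QQ> that])
    show "\<exists>\<eta>>0. mball_of m u \<eta> \<subseteq> U" if "m \<in> Q" "u \<in> mspace m" "openin ?T U" "u \<in> U" for m u U
      using mball_of_nhd_base[OF \<QQ> that] by metis
    show "open_partial_bijection ?T s" if "s \<in> S" for s
      by (rule bij[OF that])
    show "g O h \<in> S" if "g \<in> S" "h \<in> S" for g h
      using S(4) that by blast
    show "\<exists>s\<in>insert (Id_on (topspace ?T)) S. \<exists>U. openin ?T U \<and> u \<in> U \<and> (u, v) \<in> s \<and>
        s \<inter> (U \<times> UNIV) \<subseteq> holonomy_map b c"
      if "b \<in> \<B>" "c \<in> \<B>" "(u, v) \<in> holonomy_map b c" for b c u v
    proof (rule generated_pseudogroup_germ[OF bij])
      show "holonomy_map b c \<in> generated_pseudogroup ?T S"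
        using that unfolding S(2) holonomy_pseudogroup_def by (blast intro: generated_pseudogroup.generator)
    qed (use S(3,4) that in auto)
    show "\<exists>\<delta>>0. \<forall>h\<in>S. \<forall>m\<in>Q. \<forall>m'\<in>Q. \<forall>x y x' y'.
          (x, x') \<in> h \<and> (y, y') \<in> h \<and> x \<in> mspace m \<and> y \<in> mspace m \<and>
          x' \<in> mspace m' \<and> y' \<in> mspace m' \<and> mdist m x y < \<delta> \<longrightarrow> mdist m' x' y' < \<epsilon>" if "\<epsilon> > 0" for \<epsilon>
      using eq that by (elim allE[of _ \<epsilon>]) (rule mp)
  qed
  then show thesis
    by (rule that)
qed

theorem theorem17p4:
  fixes X :: "'a topology" and \<A> :: "('a, 'n::finite, 'z) flow_box set" and k :: enat
  assumes "foliated_space k X \<A>"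
    and "compact_space X"
    and "strongly_equicontinuous_foliated_space k X \<A>"
  shows "(\<forall>L \<in> leaves X \<A>. minimal_set X \<A> (X closure_of L)) \<and>
    (transitive_foliation X \<A> \<longrightarrow> minimal_foliation X \<A>)"
proof -
  have at: "foliated_atlas k X \<A>"
    using assms(1) by (simp add: foliated_space_def)
  obtain \<B> where reg: "regular_atlas k X \<B>" and AB: "foliated_atlas k X (\<A> \<union> \<B>)"
    and se: "strongly_equicontinuous (holonomy_space \<B>) (holonomy_pseudogroup \<B>)"
    using assms(3) unfolding strongly_equicontinuous_foliated_space_def by blast
  \<comment> \<open>Regularity provides the closed neighborhoods from which the charts are
    built.\<close>
  have "regular_space X"
    using assms(1) metrizable_imp_regular_space completely_metrizable_imp_metrizable_space
    unfolding foliated_space_def polish_topology_def by blast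
  from strongly_equicontinuous_imp_equicontinuous_atlas[OF reg assms(2) this se]
  obtain Q S where "equicontinuous_atlas k X \<B> Q S" .
  then interpret equicontinuous_atlas k X \<B> Q S .
  have leaves: "leaves X \<A> = leaves X \<B>"
    unfolding leaves_def using leaf_topology_eq[OF at atlas AB] by simp
  \<comment> \<open>This is the whole of minimality: a leaf inside the closure of \<open>L\<close>
    approaches \<open>L\<close> in turn, so the two closures coincide.\<close>
  have closure_eq: "X closure_of L' = X closure_of L"
    if L: "L \<in> leaves X \<A>" "L' \<in> leaves X \<A>" "L' \<subseteq> X closure_of L" for L L'
  proof
    show "X closure_of L' \<subseteq> X closure_of L"
      using L(3) by (simp add: closure_of_minimal)
    obtain q where "q \<in> L'"
      using L(2) nonempty_connected_components_of unfolding leaves_def by blast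
    then have "L \<subseteq> X closure_of L'"
      using leaf_subset_closure_of_approached_leaf L unfolding leaves by blast
    then show "X closure_of L \<subseteq> X closure_of L'"
      by (simp add: closure_of_minimal)
  qed
  have minimal: "minimal_set X \<A> (X closure_of L)" if L: "L \<in> leaves X \<A>" for L
    unfolding minimal_set_def
  proof (intro conjI ballI impI)
    have sub: "L \<subseteq> X closure_of L"
      using leaf_subset_topspace[OF at L] by (rule closure_of_subset)
    then show "X closure_of L \<noteq> {}"
      using L nonempty_connected_components_of unfolding leaves_def by blast
    show "closedin X (X closure_of L)"
      by simp
    show "\<exists>\<L>\<subseteq>leaves X \<A>. X closure_of L = \<Union>\<L>"
    proof (intro exI conjI)
      let ?\<L> = "{L' \<in> leaves X \<A>. L' \<subseteq> X closure_of L}"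
      show "?\<L> \<subseteq> leaves X \<A>"
        by blast
      have Un: "\<Union>(leaves X \<A>) = topspace X"
        using topspace_leaf_topology[OF at] Union_connected_components_of unfolding leaves_def by metis
      have "p \<in> \<Union>?\<L>" if p: "p \<in> X closure_of L" for p
      proof -
        from subsetD[OF closure_of_subset_topspace p] Un
        obtain L' where L': "L' \<in> leaves X \<A>" "p \<in> L'"
          by blast
        then show ?thesis
          using leaf_subset_closure_of_leaf[OF at L _ _ p] by blast
      qed
      then show "X closure_of L = \<Union>?\<L>"
        by auto
    qed
    fix L' assume L': "L' \<in> leaves X \<A>" "L' \<subseteq> X closure_of L"
    then show "subtopology X (X closure_of L) closure_of L' = X closure_of L"
      using closure_eq[OF L L'] by (simp add: closure_of_subtopology Int_absorb1)
  qed
  \<comment> \<open>Every leaf lies in the closure of a dense leaf, and so has the same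
    closure.\<close>
  moreover have "minimal_foliation X \<A>" if "transitive_foliation X \<A>"
    using that closure_eq leaf_subset_topspace[OF at]
    unfolding transitive_foliation_def minimal_foliation_def by metis
  ultimately show ?thesis
    by blast
qed

end
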